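(* Let the ILRFPP model on $\mathbb{Z}^d$ satisfy the standing assumptions, suppose $\gamma>\theta$ and $$\frac{2d}{\theta}<\alpha<\frac{2d}{\theta}+1,$$ and set $\Delta:=\alpha-2d/\theta\in(0,1)$. Fix $x\in\mathbb{R}^d$ with $\|x\|_\infty\le1$, $x\neq0$, and let $T_n:=T(0,\lceil nx\rceil)$. Then for every $\varepsilon>0$ there is $C<\infty$ with $$\mathbb{P}\big(T_n>C\,n^{\Delta+\varepsilon}\big)\xrightarrow[n\to\infty]{}0.$$
   Context: Model (inhomogeneous long-range first-passage percolation, ILRFPP). Fix an integer $d\ge1$ and $\alpha>0$; $\|\cdot\|$ is the $\ell_1$ norm on $\mathbb{Z}^d$. The vertex weights $(V_x)_{x\in\mathbb{Z}^d}$ are i.i.d. with the law of a random variable $V$; the edge noises $\omega_{xy}=\omega_{yx}\ge0$, one for every unordered pair $\{x,y\}$ of distinct vertices of $\mathbb{Z}^d$ (all pairs are edges), are i.i.d. with the law of $\omega$, and independent of the vertex weights. The passage time of an edge is $W_{xy}:=\|x-y\|^{\alpha}\,\omega_{xy}/(V_xV_y)$. A path is a finite sequence of distinct vertices; its passage time is the sum of $W$ over its consecutive edges. $T(x,y)$ is the infimum of the passage times over all finite self-avoiding paths from $x$ to $y$. $\lceil nx\rceil$ is the coordinatewise ceiling. Standing assumptions: for fixed $\gamma,\theta,\zeta>0$, $\mathbb{P}(0<V<\infty)=1$ and $\lim_{x\to\infty}\log\mathbb{P}(V\ge x)/\log x=-\gamma$; $\lim_{x\downarrow0}\log\mathbb{P}(\omega\le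 x)/\log x=\theta$ and $\mathbb{E}\,\omega^{\zeta}<\infty$. *)

theory Defs
  imports "HOL-Probability.Probability"
begin

definition l1_norm :: "int ^ 'd \<Rightarrow> real" where
  "l1_norm x = (\<Sum>i\<in>UNIV. \<bar>real_of_int (x $ i)\<bar>)"

text \<open>Edges are unordered pairs, represented as two-element sets; the symmetry of the edge
  noises is thereby built in.\<close>

definition edges :: "(int ^ 'd) set set" where
  "edges = {{x, y} | x y. x \<noteq> y}"

definition edge_time ::
  "real \<Rightarrow> (int ^ 'd \<Rightarrow> real) \<Rightarrow> ((int ^ 'd) set \<Rightarrow> real) \<Rightarrow> int ^ 'd \<Rightarrow> int ^ 'd \<Rightarrow> real" where
  "edge_time \<alpha> v w x y = l1_norm (x - y) powr \<alpha> * w {x, y} / (v x * v y)"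

definition path_time ::
  "real \<Rightarrow> (int ^ 'd \<Rightarrow> real) \<Rightarrow> ((int ^ 'd) set \<Rightarrow> real) \<Rightarrow> (int ^ 'd) list \<Rightarrow> real" where
  "path_time \<alpha> v w p = (\<Sum>i<length p - 1. edge_time \<alpha> v w (p ! i) (p ! Suc i))"

definition paths :: "int ^ 'd \<Rightarrow> int ^ 'd \<Rightarrow> (int ^ 'd) list set" where
  "paths x y = {p. p \<noteq> [] \<and> distinct p \<and> hd p = x \<and> last p = y}"

text \<open>The infimum is taken in the extended reals, so that it is also meaningful on the null
  event where some weight is not positive or some noise is negative.\<close>

definition first_passage_time ::
  "real \<Rightarrow> (int ^ 'd \<Rightarrow> real) \<Rightarrow> ((int ^ 'd) set \<Rightarrow> real) \<Rightarrow> int ^ 'd \<Rightarrow> int ^ 'd \<Rightarrow> ereal" where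
  "first_passage_time \<alpha> v w x y = (INF p\<in>paths x y. ereal (path_time \<alpha> v w p))"

definition ceiling_vec :: "real ^ 'd \<Rightarrow> int ^ 'd" where
  "ceiling_vec x = (\<chi> i. \<lceil>x $ i\<rceil>)"

text \<open>The measures \<open>\<nu>\<close> and \<open>\<mu>\<close> are the laws of the generic vertex weight and of the generic edge
  noise. Joint independence over the disjoint union of vertices and edges says that the weights
  are independent, the noises are independent, and the two families are independent of each
  other.\<close>

locale ilrfpp = prob_space M
  for M :: "'a measure" +
  fixes \<alpha> :: real
    and V :: "int ^ 'd \<Rightarrow> 'a \<Rightarrow> real"
    and \<omega> :: "(int ^ 'd) set \<Rightarrow> 'a \<Rightarrow> real"
    and \<nu> \<mu> :: "real measure"
  assumes alpha_pos: "\<alpha> > 0"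
    and indep: "indep_vars (\<lambda>_. borel) (case_sum V \<omega>) (UNIV <+> edges)"
    and law_V: "\<And>x. distr M borel (V x) = \<nu>"
    and law_omega: "\<And>e. e \<in> edges \<Longrightarrow> distr M borel (\<omega> e) = \<mu>"
    and omega_nonneg: "AE s in \<mu>. 0 \<le> s"

text \<open>Since \<open>ln 0 = 0\<close>, a weight law with bounded support, or a noise law with no mass near
  \<open>0\<close>, makes the corresponding quotient below tend to \<open>0\<close>. As \<open>\<gamma>\<close> and \<open>\<theta>\<close> are positive, the
  limit conditions exclude such laws, exactly as they do under the convention that \<open>log 0\<close> is
  minus infinity.\<close>

locale ilrfpp_standing = ilrfpp M \<alpha> V \<omega> \<nu> \<mu>
  for M :: "'a measure"
    and \<alpha> :: real
    and V :: "int ^ 'd \<Rightarrow> 'a \<Rightarrow> real"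
    and \<omega> :: "(int ^ 'd) set \<Rightarrow> 'a \<Rightarrow> real"
    and \<nu> \<mu> :: "real measure" +
  fixes \<gamma> \<theta> \<zeta> :: real
  assumes gamma_pos: "\<gamma> > 0" and theta_pos: "\<theta> > 0" and zeta_pos: "\<zeta> > 0"
    and V_pos: "AE t in \<nu>. 0 < t"
    and V_tail: "((\<lambda>t. ln (measure \<nu> {t..}) / ln t) \<longlongrightarrow> - \<gamma>) at_top"
    and omega_near_0: "((\<lambda>t. ln (measure \<mu> {..t}) / ln t) \<longlongrightarrow> \<theta>) (at_right 0)"
    and omega_moment: "integrable \<mu> (\<lambda>s. s powr \<zeta>)"

end

theory Submission
  imports Defs "HOL-Real_Asymp.Real_Asymp"
begin

text \<open>
  Call a vertex heavy at stage \<open>n\<close> if its weight is at least \<open>n powr - \<eta>\<close>, for a small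
  \<open>\<eta> > 0\<close>. Weights are positive, so a given vertex is heavy with probability tending to
  \<open>1\<close>; heaviness costs at most a factor \<open>n powr (2 * \<eta>)\<close> in the time of an edge, and then
  the weights can be forgotten.

  Two cubes of side of order \<open>r\<close> have about \<open>r ^ (2 * d)\<close> edges between them, and a noise is
  below \<open>t\<close> with probability about \<open>t powr \<theta>\<close>, so the smallest noise among these edges is about
  \<open>r powr (- 2 * d / \<theta>)\<close>. If the cubes are at distance of order \<open>n powr b\<close> and \<open>r\<close> is
  \<open>n powr (\<beta> * b)\<close> with \<open>\<beta> < 1\<close> close to \<open>1\<close>, the corresponding edge takes time
  about \<open>n powr (b * (\<alpha> - \<beta> * 2 * d / \<theta>))\<close>, which is at most
  \<open>n powr (\<Delta> + \<epsilon>)\<close> because \<open>b \<le> 1\<close> and \<open>\<Delta> > 0\<close>. It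
  replaces the connection of two vertices at distance \<open>n powr b\<close> by two connections at
  distance \<open>n powr (\<beta> * b)\<close>. The scales \<open>n powr 1\<close>, \<open>n powr \<beta>\<close>,
  \<open>n powr (\<beta> ^ 2)\<close>, and so on reach an arbitrarily small power of \<open>n\<close> after a number of
  steps that does not depend on \<open>n\<close>, so only boundedly many edges are used in all. At the smallest
  scale a route through one intermediate vertex, with two short edges of unexceptional noise, is fast
  enough.

  The endpoints found at one scale depend on the environment. The remedy is uniformity: at a fixed scale
  the required edge fails to exist with probability at most \<open>exp (- (n powr e))\<close> up to constants, for some \<open>e > 0\<close>
  (\<open>prob_no_link\<close> and \<open>prob_no_relay\<close>), and a union bound over the polynomially many pairs of
  vertices in a cube of side of order \<open>n\<close> gives it for all pairs at once (\<open>whp_link\<close> and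
  \<open>whp_relay\<close>). Conditionally on that, the recursion is deterministic; it is carried by
  \<open>connected_at_small_scale\<close> and \<open>connected_at_larger_scale\<close>.
\<close>

section \<open>Walks and loop erasure\<close>

text \<open>Walks may repeat vertices, so that they can be concatenated freely.\<close>

definition walk_within ::
  "real \<Rightarrow> (int ^ 'd \<Rightarrow> real) \<Rightarrow> ((int ^ 'd) set \<Rightarrow> real) \<Rightarrow> int ^ 'd \<Rightarrow> int ^ 'd \<Rightarrow> real \<Rightarrow> bool" where
  "walk_within \<alpha> v w x y C \<longleftrightarrow> (\<exists>p. p \<noteq> [] \<and> hd p = x \<and> last p = y \<and> path_time \<alpha> v w p \<le> C)"

lemma path_time_singleton [simp]: "path_time \<alpha> v w [x] = 0"
  by (simp add: path_time_def)

lemma path_time_Cons_Cons [simp]: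
  "path_time \<alpha> v w (x # y # p) = edge_time \<alpha> v w x y + path_time \<alpha> v w (y # p)"
  by (simp add: path_time_def sum.lessThan_Suc_shift del: sum.lessThan_Suc)

lemma path_time_append:
  "path_time \<alpha> v w (xs @ y # ys) = path_time \<alpha> v w (xs @ [y]) + path_time \<alpha> v w (y # ys)"
proof (induction xs)
  case (Cons a xs)
  then show ?case by (cases xs) auto
qed simp

lemma edge_time_nonneg:
  assumes "\<And>z. 0 < v z" "\<And>e. e \<in> edges \<Longrightarrow> 0 \<le> w e"
  shows "0 \<le> edge_time \<alpha> v w x y"
proof (cases "x = y")
  case False
  then have "{x, y} \<in> edges" by (auto simp: edges_def)
  then show ?thesis using assms by (auto simp: edge_time_def intro!: divide_nonneg_pos)
qed (simp add: edge_time_def l1_norm_def)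

lemma path_time_nonneg:
  assumes "\<And>z. 0 < v z" "\<And>e. e \<in> edges \<Longrightarrow> 0 \<le> w e"
  shows "0 \<le> path_time \<alpha> v w p"
  unfolding path_time_def by (intro sum_nonneg edge_time_nonneg assms)

text \<open>A repeated vertex encloses a loop, and with nonnegative edge times cutting it out does not slow
  the walk down.\<close>

lemma loop_erasure:
  assumes "\<And>z. 0 < v z" "\<And>e. e \<in> edges \<Longrightarrow> 0 \<le> w e" and "p \<noteq> []"
  shows "\<exists>q \<in> paths (hd p) (last p). path_time \<alpha> v w q \<le> path_time \<alpha> v w p"
  using \<open>p \<noteq> []\<close>
proof (induction p rule: length_induct)
  case (1 p)
  show ?case
  proof (cases "distinct p")
    case True
    then show ?thesis using 1 by (auto simp: paths_def)
  next
    case False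
    then obtain xs ys zs y where p: "p = xs @ [y] @ ys @ [y] @ zs"
      using not_distinct_decomp by blast
    let ?q = "xs @ [y] @ zs"
    have "path_time \<alpha> v w p = path_time \<alpha> v w (xs @ [y])
        + (path_time \<alpha> v w ((y # ys) @ [y]) + path_time \<alpha> v w (y # zs))"
      using path_time_append[of \<alpha> v w xs y "ys @ y # zs"] path_time_append[of \<alpha> v w "y # ys" y zs]
      by (simp add: p)
    moreover have "path_time \<alpha> v w ?q = path_time \<alpha> v w (xs @ [y]) + path_time \<alpha> v w (y # zs)"
      using path_time_append[of \<alpha> v w xs y zs] by simp
    moreover have "0 \<le> path_time \<alpha> v w ((y # ys) @ [y])"
      by (rule path_time_nonneg[OF assms(1,2)])
    ultimately have "path_time \<alpha> v w ?q \<le> path_time \<alpha> v w p" by linarith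
    moreover have "length ?q < length p" "?q \<noteq> []" "hd ?q = hd p" "last ?q = last p"
      by (auto simp: p hd_append)
    ultimately show ?thesis using 1(1) by fastforce
  qed
qed

lemma first_passage_time_le_walk:
  assumes "\<And>z. 0 < v z" "\<And>e. e \<in> edges \<Longrightarrow> 0 \<le> w e" and "walk_within \<alpha> v w x y C"
  shows "first_passage_time \<alpha> v w x y \<le> ereal C"
proof -
  obtain p where p: "p \<noteq> []" "hd p = x" "last p = y" "path_time \<alpha> v w p \<le> C"
    using assms(3) by (auto simp: walk_within_def)
  obtain q where "q \<in> paths x y" "path_time \<alpha> v w q \<le> path_time \<alpha> v w p"
    using loop_erasure[of v w p \<alpha>] assms(1,2) p by blast
  then show ?thesis
    using p(4) by (auto simp: first_passage_time_def intro!: INF_lower2[of q])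
qed

lemma walk_within_edge: "edge_time \<alpha> v w x y \<le> C \<Longrightarrow> walk_within \<alpha> v w x y C"
  unfolding walk_within_def by (rule exI[of _ "[x, y]"]) simp

lemma walk_within_mono: "walk_within \<alpha> v w x y C \<Longrightarrow> C \<le> D \<Longrightarrow> walk_within \<alpha> v w x y D"
  unfolding walk_within_def using order_trans by blast

lemma walk_within_trans:
  assumes "walk_within \<alpha> v w x y C" "walk_within \<alpha> v w y z D"
  shows "walk_within \<alpha> v w x z (C + D)"
proof -
  obtain p where p: "p \<noteq> []" "hd p = x" "last p = y" "path_time \<alpha> v w p \<le> C"
    using assms(1) by (auto simp: walk_within_def)
  obtain q where q: "q \<noteq> []" "hd q = y" "last q = z" "path_time \<alpha> v w q \<le> D"
    using assms(2) by (auto simp: walk_within_def)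
  have peq: "p = butlast p @ [y]" and qeq: "q = y # tl q"
    using p q by (metis append_butlast_last_id, metis list.collapse)
  have "path_time \<alpha> v w (butlast p @ y # tl q) \<le> C + D"
    using p(4) q(4) path_time_append[of \<alpha> v w "butlast p" y "tl q"] peq qeq by simp
  moreover have "hd (butlast p @ y # tl q) = x"
    using p(2) peq by (metis hd_append list.sel(1))
  moreover have "last (butlast p @ y # tl q) = z"
    using q(1,3) qeq by (metis last_appendR)
  ultimately show ?thesis unfolding walk_within_def by blast
qed

section \<open>Cubes in the integer lattice\<close>

definition cube :: "int ^ 'd \<Rightarrow> real \<Rightarrow> (int ^ 'd) set" where
  "cube u \<rho> = {w. \<forall>i. \<bar>real_of_int (w $ i - u $ i)\<bar> \<le> \<rho>}"

lemma cube_eq_vec_image: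
  fixes u :: "int ^ 'd"
  shows "cube u \<rho> = vec_lambda ` (PiE UNIV (\<lambda>i. {u $ i - \<lfloor>\<rho>\<rfloor>..u $ i + \<lfloor>\<rho>\<rfloor>}))"
proof -
  have "\<bar>real_of_int k\<bar> \<le> \<rho> \<longleftrightarrow> \<bar>k\<bar> \<le> \<lfloor>\<rho>\<rfloor>" for k
    by (simp add: le_floor_iff)
  then have "w \<in> cube u \<rho> \<longleftrightarrow> vec_nth w \<in> PiE UNIV (\<lambda>i. {u $ i - \<lfloor>\<rho>\<rfloor>..u $ i + \<lfloor>\<rho>\<rfloor>})" for w
    unfolding cube_def PiE_iff mem_Collect_eq atLeastAtMost_iff
    by (simp only: abs_diff_le_iff[symmetric] simp_thms) auto
  then have "cube u \<rho> = vec_nth -` (PiE UNIV (\<lambda>i. {u $ i - \<lfloor>\<rho>\<rfloor>..u $ i + \<lfloor>\<rho>\<rfloor>}))" by blast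
  moreover have "vec_nth -` S = vec_lambda ` S" for S :: "('d \<Rightarrow> int) set"
    by (auto simp: vec_lambda_inverse intro!: image_eqI[where x = "vec_nth _"])
  ultimately show ?thesis by simp
qed

lemma finite_cube: "finite (cube u \<rho>)"
  unfolding cube_eq_vec_image by (intro finite_imageI finite_PiE) auto

lemma card_cube:
  fixes u :: "int ^ 'd"
  assumes "0 \<le> \<rho>"
  shows "real (card (cube u \<rho>)) = (2 * real_of_int \<lfloor>\<rho>\<rfloor> + 1) ^ CARD('d)"
proof -
  let ?S = "\<lambda>i. {u $ i - \<lfloor>\<rho>\<rfloor>..u $ i + \<lfloor>\<rho>\<rfloor>}"
  have "inj_on vec_lambda (PiE UNIV ?S)"
    by (auto simp: inj_on_def vec_lambda_inject)
  then have "card (cube u \<rho>) = (\<Prod>i\<in>UNIV. card (?S i))"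
    by (simp add: cube_eq_vec_image card_image card_PiE)
  also have "\<dots> = nat (2 * \<lfloor>\<rho>\<rfloor> + 1) ^ CARD('d)" by simp
  finally show ?thesis using assms by (simp add: of_nat_power)
qed

lemma card_cube_ge:
  fixes u :: "int ^ 'd"
  assumes "0 \<le> \<rho>"
  shows "\<rho> ^ CARD('d) \<le> real (card (cube u \<rho>))"
  unfolding card_cube[OF assms] using assms zero_le_floor[of \<rho>]
  by (intro power_mono) linarith+

lemma card_cube_le:
  fixes u :: "int ^ 'd"
  assumes "0 \<le> \<rho>"
  shows "real (card (cube u \<rho>)) \<le> (2 * \<rho> + 1) ^ CARD('d)"
  unfolding card_cube[OF assms] using assms by (intro power_mono) auto

lemma cube_commute: "v \<in> cube u \<rho> \<longleftrightarrow> u \<in> cube v \<rho>"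
  by (simp add: cube_def abs_minus_commute)

lemma cube_trans:
  assumes "v \<in> cube u \<rho>" "w \<in> cube v \<sigma>"
  shows "w \<in> cube u (\<rho> + \<sigma>)"
proof -
  have "\<bar>real_of_int (w $ i - u $ i)\<bar> \<le> \<rho> + \<sigma>" for i
  proof -
    have "\<bar>real_of_int (v $ i - u $ i)\<bar> \<le> \<rho>" "\<bar>real_of_int (w $ i - v $ i)\<bar> \<le> \<sigma>"
      using assms by (auto simp: cube_def)
    then show ?thesis by (simp add: abs_le_iff)
  qed
  then show ?thesis by (simp add: cube_def)
qed

lemma cube_mono: "\<rho> \<le> \<sigma> \<Longrightarrow> cube u \<rho> \<subseteq> cube u \<sigma>"
  by (auto simp: cube_def intro: order_trans)

lemma l1_norm_le_cube:
  fixes u v :: "int ^ 'd"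
  assumes "v \<in> cube u \<rho>"
  shows "l1_norm (u - v) \<le> real CARD('d) * \<rho>"
proof -
  have "l1_norm (u - v) \<le> (\<Sum>i\<in>(UNIV::'d set). \<rho>)"
    unfolding l1_norm_def using assms
    by (intro sum_mono) (simp add: cube_def abs_minus_commute)
  then show ?thesis by simp
qed

lemma edge_time_le:
  fixes u v :: "int ^ 'd"
  assumes "v \<in> cube u \<rho>" "0 < \<alpha>" "0 < c" "0 < c'" "c \<le> wt u" "c' \<le> wt v" "0 \<le> w {u, v}" "w {u, v} \<le> t"
  shows "edge_time \<alpha> wt w u v \<le> (real CARD('d) * \<rho>) powr \<alpha> * t / (c * c')"
  unfolding edge_time_def
proof (rule frac_le)
  show "l1_norm (u - v) powr \<alpha> * w {u, v} \<le> (real CARD('d) * \<rho>) powr \<alpha> * t"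
    by (intro mult_mono powr_mono2 l1_norm_le_cube assms)
      (use assms in \<open>auto simp: l1_norm_def intro: sum_nonneg\<close>)
qed (use assms in \<open>auto intro!: mult_mono\<close>)

section \<open>Failure probabilities for fixed vertices\<close>

text \<open>A crude substitute for a large deviation bound: if a third of the independent events
  occur, then all events indexed by some set \<open>T\<close> of at least that size occur. There are at most
  \<open>2 ^ card K\<close> such sets, each contributing at most \<open>(1 / 64) ^ card T\<close>, which is at most
  \<open>(1 / 4) ^ card K\<close>. The constant \<open>64\<close> is \<open>4 ^ 3\<close>. The map \<open>f\<close> selects
  the variables in question from a larger independent family.\<close>

lemma (in prob_space) prob_many_failures:
  assumes indep: "indep_vars (\<lambda>_. N) X I" and fin: "finite K"
    and f: "inj_on f K" "f ` K \<subseteq> I" and B: "B \<in> sets N"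
    and small: "\<And>k. k \<in> K \<Longrightarrow> prob (X (f k) -` B \<inter> space M) \<le> 1 / 64"
  defines "E \<equiv> {s \<in> space M. card K \<le> 3 * card {k \<in> K. X (f k) s \<in> B}}"
  shows "E \<in> events" and "prob E \<le> (1 / 2) ^ card K"
proof -
  have "E \<in> events \<and> prob E \<le> (1 / 2) ^ card K"
  proof (cases "K = {}")
    case True
    then have "E = space M" by (simp add: E_def)
    then show ?thesis using True by simp
  next
    case False
    define \<T> where "\<T> = {T. T \<subseteq> K \<and> card K \<le> 3 * card T}"
    define F where "F = (\<lambda>T. \<Inter>k\<in>T. X (f k) -` B \<inter> space M)"
    have rv: "random_variable N (X (f k))" if "k \<in> K" for k
      using indep f that by (auto simp: indep_vars_def)
    have fin\<T>: "finite \<T>" unfolding \<T>_def using fin by simp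
    have T: "T \<noteq> {}" "finite T" "T \<subseteq> K" if "T \<in> \<T>" for T
      using that False fin by (auto simp: \<T>_def finite_subset)
    have F_ev: "F T \<in> events" if "T \<in> \<T>" for T
      unfolding F_def using T[OF that] rv B by (intro sets.finite_INT measurable_sets) auto
    have E_eq: "E = (\<Union>T\<in>\<T>. F T)"
    proof (intro equalityI subsetI)
      fix s assume "s \<in> E"
      then show "s \<in> (\<Union>T\<in>\<T>. F T)"
        by (intro UN_I[of "{k \<in> K. X (f k) s \<in> B}"]) (auto simp: E_def \<T>_def F_def)
    next
      fix s assume "s \<in> (\<Union>T\<in>\<T>. F T)"
      then obtain T where sT: "T \<in> \<T>" "s \<in> F T" by blast
      have "card T \<le> card {k \<in> K. X (f k) s \<in> B}"
        using sT T[OF sT(1)] fin by (intro card_mono) (auto simp: F_def)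
      then show "s \<in> E" using sT T[OF sT(1)] by (auto simp: E_def \<T>_def F_def)
    qed
    have "prob E \<le> (\<Sum>T\<in>\<T>. prob (F T))"
      unfolding E_eq using fin\<T> F_ev by (intro finite_measure_subadditive_finite) auto
    also have "\<dots> \<le> (\<Sum>T\<in>\<T>. (1 / 4) ^ card K)"
    proof (rule sum_mono)
      fix T assume TT: "T \<in> \<T>"
      note inj = inj_on_subset[OF f(1) T(3)[OF TT]]
      have "prob (F T) = prob (\<Inter>i\<in>f ` T. X i -` B \<inter> space M)"
        by (simp add: F_def)
      also have "\<dots> = (\<Prod>i\<in>f ` T. prob (X i -` B \<inter> space M))"
        using T[OF TT] f B by (intro indep_varsD[OF indep]) auto
      also have "\<dots> = (\<Prod>k\<in>T. prob (X (f k) -` B \<inter> space M))"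
        by (simp add: prod.reindex[OF inj])
      also have "\<dots> \<le> (\<Prod>k\<in>T. 1 / 64)"
        using T[OF TT] small by (intro prod_mono) auto
      also have "\<dots> = (1 / 4) ^ (3 * card T)"
        by (simp add: power_mult power3_eq_cube)
      also have "\<dots> \<le> (1 / 4) ^ card K"
        using TT by (intro power_decreasing) (auto simp: \<T>_def)
      finally show "prob (F T) \<le> (1 / 4) ^ card K" .
    qed
    also have "\<dots> = real (card \<T>) * (1 / 4) ^ card K" by simp
    also have "\<dots> \<le> real (card (Pow K)) * (1 / 4) ^ card K"
      using fin by (intro mult_right_mono of_nat_mono card_mono) (auto simp: \<T>_def)
    also have "\<dots> = (1 / 2) ^ card K"
      using fin by (simp add: card_Pow power_mult_distrib[symmetric])
    finally show ?thesis using F_ev fin\<T> unfolding E_eq by auto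
  qed
  then show "E \<in> events" and "prob E \<le> (1 / 2) ^ card K" by simp_all
qed

context ilrfpp
begin

lemma V_measurable [measurable]: "V x \<in> borel_measurable M"
  using indep unfolding indep_vars_def by (auto dest: bspec[of _ _ "Inl x"])

lemma omega_measurable: "e \<in> edges \<Longrightarrow> \<omega> e \<in> borel_measurable M"
  using indep unfolding indep_vars_def by (auto dest: bspec[of _ _ "Inr e"])

lemma prob_V: "S \<in> sets borel \<Longrightarrow> prob (V x -` S \<inter> space M) = measure \<nu> S"
  using law_V[of x] by (metis V_measurable measure_distr)

lemma prob_omega: "e \<in> edges \<Longrightarrow> S \<in> sets borel \<Longrightarrow> prob (\<omega> e -` S \<inter> space M) = measure \<mu> S"
  using law_omega[of e] by (metis omega_measurable measure_distr)

lemma prob_space_nu: "prob_space \<nu>"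
  using prob_space_distr[of "V undefined" borel] V_measurable law_V by metis

lemma sets_nu: "sets \<nu> = sets borel"
  using law_V sets_distr by metis

lemma space_nu [simp]: "space \<nu> = UNIV"
  using law_V space_distr space_borel by metis

lemma doubleton_mem_edges: "x \<noteq> y \<Longrightarrow> {x, y} \<in> edges"
  by (auto simp: edges_def)

lemma edges_nonempty: "edges \<noteq> ({} :: (int ^ 'd) set set)"
proof -
  have "(0 :: int ^ 'd) \<noteq> 1" by (simp add: vec_eq_iff)
  then show ?thesis using doubleton_mem_edges by blast
qed

lemma prob_space_mu: "prob_space \<mu>"
  using edges_nonempty prob_space_distr omega_measurable law_omega by (metis ex_in_conv)

lemma sets_mu: "sets \<mu> = sets borel"
  using edges_nonempty law_omega sets_distr by (metis ex_in_conv)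

lemma space_mu [simp]: "space \<mu> = UNIV"
  using edges_nonempty law_omega space_distr space_borel by (metis ex_in_conv)

lemma prob_many_bad_vertices:
  assumes "finite A" "measure \<nu> {..<c} \<le> 1 / 64"
  shows "{s \<in> space M. card A \<le> 3 * card {i \<in> A. V i s < c}} \<in> events"
    and "prob {s \<in> space M. card A \<le> 3 * card {i \<in> A. V i s < c}} \<le> (1 / 2) ^ card A"
  using prob_many_failures[OF indep, of A Inl "{..<c}"] assms by (auto simp: prob_V)

lemma prob_many_bad_star_edges:
  assumes "finite A" "u \<notin> A" "measure \<mu> {K<..} \<le> 1 / 64"
  shows "{s \<in> space M. card A \<le> 3 * card {i \<in> A. K < \<omega> {u, i} s}} \<in> events"
    and "prob {s \<in> space M. card A \<le> 3 * card {i \<in> A. K < \<omega> {u, i} s}} \<le> (1 / 2) ^ card A"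
proof -
  have "prob (\<omega> {u, i} -` {K<..} \<inter> space M) \<le> 1 / 64" if "i \<in> A" for i
  proof -
    have "u \<noteq> i" using that assms(2) by blast
    then show ?thesis using prob_omega[OF doubleton_mem_edges, of u i "{K<..}"] assms(3) by simp
  qed
  moreover have "inj_on (\<lambda>z. Inr {u, z} :: (int ^ 'd) + (int ^ 'd) set) A"
    by (auto simp: inj_on_def doubleton_eq_iff)
  moreover have "(\<lambda>z. Inr {u, z}) ` A \<subseteq> UNIV <+> edges"
    using assms(2) by (auto simp: edges_def)
  ultimately show "{s \<in> space M. card A \<le> 3 * card {i \<in> A. K < \<omega> {u, i} s}} \<in> events"
    and "prob {s \<in> space M. card A \<le> 3 * card {i \<in> A. K < \<omega> {u, i} s}} \<le> (1 / 2) ^ card A"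
    using prob_many_failures[OF indep assms(1), of "\<lambda>z. Inr {u, z}" "{K<..}"] by simp_all
qed

text \<open>If no \<open>z\<close> in \<open>Z\<close> is a heavy vertex joined to \<open>u\<close> and to \<open>v\<close> by edges
  of moderate noise, then one of the three requirements fails for at least a third of \<open>Z\<close>. Each
  of the three families is independent, and the three probabilities add up.\<close>

lemma prob_no_relay:
  assumes fin: "finite Z" and uv: "u \<notin> Z" "v \<notin> Z"
    and c: "measure \<nu> {..<c} \<le> 1 / 64" and K: "measure \<mu> {K<..} \<le> 1 / 64"
  shows "\<exists>E \<in> events. prob E \<le> 3 * (1 / 2) ^ card Z \<and>
    {s \<in> space M. \<forall>z\<in>Z. \<not> (c \<le> V z s \<and> \<omega> {u, z} s \<le> K \<and> \<omega> {v, z} s \<le> K)} \<subseteq> E"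
proof -
  define A where "A = {s \<in> space M. card Z \<le> 3 * card {i \<in> Z. V i s < c}}"
  define B where "B x = {s \<in> space M. card Z \<le> 3 * card {i \<in> Z. K < \<omega> {x, i} s}}" for x
  have A: "A \<in> events" "prob A \<le> (1 / 2) ^ card Z"
    unfolding A_def by (rule prob_many_bad_vertices[OF fin c])+
  have B: "B u \<in> events" "prob (B u) \<le> (1 / 2) ^ card Z" "B v \<in> events" "prob (B v) \<le> (1 / 2) ^ card Z"
    unfolding B_def by (rule prob_many_bad_star_edges[OF fin uv(1) K] prob_many_bad_star_edges[OF fin uv(2) K])+
  have "prob (A \<union> (B u \<union> B v)) \<le> 3 * (1 / 2) ^ card Z"
    using measure_Un_le[of A M "B u \<union> B v"] measure_Un_le[of "B u" M "B v"] A B by auto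
  moreover have "s \<in> A \<union> (B u \<union> B v)" if s: "s \<in> space M"
    and none: "\<forall>z\<in>Z. \<not> (c \<le> V z s \<and> \<omega> {u, z} s \<le> K \<and> \<omega> {v, z} s \<le> K)" for s
  proof -
    let ?P = "{i \<in> Z. V i s < c}" and ?Q = "\<lambda>u. {i \<in> Z. K < \<omega> {u, i} s}"
    have "card Z \<le> card (?P \<union> (?Q u \<union> ?Q v))"
      using none fin by (intro card_mono) (auto simp: not_le)
    also have "\<dots> \<le> card ?P + card (?Q u \<union> ?Q v)" by (rule card_Un_le)
    also have "card (?Q u \<union> ?Q v) \<le> card (?Q u) + card (?Q v)" by (rule card_Un_le)
    finally show ?thesis using s unfolding A_def B_def by auto
  qed
  ultimately show ?thesis using A(1) B(1,3) by (intro bexI[of _ "A \<union> (B u \<union> B v)"] conjI subsetI) auto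
qed

text \<open>The edges between \<open>A\<close> and \<open>B\<close> are not independently usable, since they share
  the weights of their endpoints. Splitting according to the exact set \<open>R\<close> of heavy vertices in
  \<open>A \<union> B\<close> restores independence: outside two events of exponentially small probability,
  \<open>R\<close> contains two thirds of each side, and given such an \<open>R\<close> the noises of its
  edges are independent, which leaves \<open>(1 - q) ^ k\<close> with \<open>k\<close> at least
  \<open>4 / 9 * card A * card B\<close> and \<open>q\<close> the probability of a noise at most \<open>t\<close>.\<close>

lemma prob_no_link:
  assumes fin: "finite A" "finite B" and disj: "A \<inter> B = {}" 
    and c: "measure \<nu> {..<c} \<le> 1 / 64"
  shows "\<exists>E \<in> events.
    prob E \<le> (1 / 2) ^ card A + (1 / 2) ^ card B
        + exp (- (4 / 9 * real (card A) * real (card B) * measure \<mu> {..t})) \<and>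
    {s \<in> space M. \<forall>a\<in>A. \<forall>b\<in>B. \<not> (c \<le> V a s \<and> c \<le> V b s \<and> \<omega> {a, b} s \<le> t)} \<subseteq> E"
proof (cases "A \<union> B = {}")
  case True
  then show ?thesis by (intro bexI[of _ "space M"]) (auto simp: prob_space)
next
  case False
  interpret \<nu>: prob_space \<nu> by (rule prob_space_nu)
  interpret \<mu>: prob_space \<mu> by (rule prob_space_mu)
  let ?U = "A \<union> B"
  define p where "p = measure \<nu> {c..}"
  define p' where "p' = measure \<nu> {..<c}"
  define q where "q = measure \<mu> {..t}"
  have p: "p + p' = 1" "0 \<le> p" "0 \<le> p'"
  proof -
    have "UNIV - {..<c} = {c..}" by auto
    then show "p + p' = 1"
      using \<nu>.prob_compl[of "{..<c}"] by (auto simp: p_def p'_def sets_nu)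
  qed (auto simp: p_def p'_def)
  have q: "measure \<mu> {t<..} = 1 - q"
  proof -
    have "UNIV - {..t} = {t<..}" by auto
    then show ?thesis using \<mu>.prob_compl[of "{..t}"] by (auto simp: q_def sets_mu)
  qed
  \<comment> \<open>For a prescribed set \<open>R\<close> of heavy vertices: the edges between its two parts are \<open>E R\<close>,
    and \<open>F R\<close> says that \<open>R\<close> is exactly the set of heavy vertices and that none of these
    edges has a small noise.\<close>
  define E where "E R = (\<lambda>(a, b). {a, b}) ` ((R \<inter> A) \<times> (R \<inter> B))" for R
  define J where "J R = ?U <+> E R" for R
  define Y where "Y R j = case_sum (\<lambda>i. if i \<in> R then {c..} else {..<c}) (\<lambda>e. {t<..}) j"
    for R and j :: "(int ^ 'd) + (int ^ 'd) set"
  define F where "F R = (\<Inter>j\<in>J R. case_sum V \<omega> j -` Y R j \<inter> space M)" for R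
  have E_edges: "E R \<subseteq> edges" for R
    using disj by (auto simp: E_def intro!: doubleton_mem_edges)
  have finE: "finite (E R)" for R using fin by (auto simp: E_def)
  have cardE: "card (E R) = card (R \<inter> A) * card (R \<inter> B)" for R
  proof -
    have "inj_on (\<lambda>(a, b). {a, b}) ((R \<inter> A) \<times> (R \<inter> B))"
      using disj by (auto simp: inj_on_def doubleton_eq_iff)
    then show ?thesis by (simp add: E_def card_image card_cartesian_product)
  qed
  have J: "J R \<noteq> {}" "finite (J R)" "J R \<subseteq> UNIV <+> edges" for R
    using False fin finE E_edges by (auto simp: J_def)
  have Y: "Y R j \<in> sets borel" for R j by (auto simp: Y_def split: sum.split)
  have rv: "case_sum V \<omega> j \<in> borel_measurable M" if "j \<in> J R" for j R
    using that E_edges[of R] by (auto simp: J_def intro!: omega_measurable)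
  have F_ev: "F R \<in> events" for R
    unfolding F_def using J by (intro sets.finite_INT measurable_sets[OF rv Y])
  have prob_F: "prob (F R) = (\<Prod>i\<in>R. p) * (\<Prod>i\<in>?U - R. p') * (1 - q) ^ card (E R)"
    if R: "R \<subseteq> ?U" for R
  proof -
    have "prob (F R) = (\<Prod>j\<in>J R. prob (case_sum V \<omega> j -` Y R j \<inter> space M))"
      unfolding F_def using J Y by (intro indep_varsD[OF indep]) auto
    also have "\<dots> = (\<Prod>i\<in>?U. prob (V i -` (if i \<in> R then {c..} else {..<c}) \<inter> space M))
        * (\<Prod>e\<in>E R. prob (\<omega> e -` {t<..} \<inter> space M))"
      unfolding J_def using fin finE by (subst prod.Plus) (auto simp: Y_def)
    also have "(\<Prod>e\<in>E R. prob (\<omega> e -` {t<..} \<inter> space M)) = (\<Prod>e\<in>E R. 1 - q)"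
      using E_edges[of R] q by (intro prod.cong) (auto simp: prob_omega)
    also have "(\<Prod>i\<in>?U. prob (V i -` (if i \<in> R then {c..} else {..<c}) \<inter> space M))
        = (\<Prod>i\<in>?U. if i \<in> R then p else p')"
      by (intro prod.cong) (auto simp: prob_V p_def p'_def)
    also have "\<dots> = (\<Prod>i\<in>R. p) * (\<Prod>i\<in>?U - R. p')"
    proof -
      have "?U \<inter> {i. i \<in> R} = R" "?U \<inter> - {i. i \<in> R} = ?U - R" using R by auto
      then show ?thesis using fin by (simp only: prod.If_cases finite_Un simp_thms)
    qed
    finally show ?thesis by simp
  qed
  define \<R> where "\<R> = {R. R \<subseteq> ?U \<and> 2 * card A \<le> 3 * card (R \<inter> A) \<and> 2 * card B \<le> 3 * card (R \<inter> B)}"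
  have fin\<R>: "finite \<R>" unfolding \<R>_def using fin by simp
  define x where "x = exp (- (4 / 9 * real (card A) * real (card B) * q))"
  have tail: "(1 - q) ^ card (E R) \<le> x" if "R \<in> \<R>" for R
  proof -
    have "0 \<le> q" "q \<le> 1" by (auto simp: q_def)
    have "(1 - q) ^ card (E R) \<le> exp (- q) ^ card (E R)"
      using \<open>q \<le> 1\<close> exp_ge_add_one_self[of "- q"] by (intro power_mono) auto
    also have "\<dots> = exp (- (real (card (E R)) * q))" by (simp add: exp_of_nat_mult[symmetric])
    also have "\<dots> \<le> x"
    proof -
      have "(2 / 3 * real (card A)) * (2 / 3 * real (card B)) \<le> real (card (R \<inter> A)) * real (card (R \<inter> B))"
        using that by (intro mult_mono) (auto simp: \<R>_def)
      then have "4 / 9 * real (card A) * real (card B) \<le> real (card (E R))"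
        by (simp add: cardE)
      then show ?thesis unfolding x_def using mult_right_mono[OF _ \<open>0 \<le> q\<close>] by fastforce
    qed
    finally show ?thesis .
  qed
  have "prob (\<Union>R\<in>\<R>. F R) \<le> (\<Sum>R\<in>\<R>. prob (F R))"
    using fin\<R> F_ev by (intro finite_measure_subadditive_finite) auto
  also have "\<dots> \<le> (\<Sum>R\<in>\<R>. (\<Prod>i\<in>R. p) * (\<Prod>i\<in>?U - R. p') * x)"
    using tail p by (intro sum_mono) (auto simp: prob_F \<R>_def intro!: mult_left_mono)
  also have "\<dots> \<le> (\<Sum>R\<in>Pow ?U. (\<Prod>i\<in>R. p) * (\<Prod>i\<in>?U - R. p') * x)"
    using fin p by (intro sum_mono2) (auto simp: \<R>_def x_def)
  \<comment> \<open>The probabilities of the possible sets of heavy vertices add up to \<open>1\<close>.\<close>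
  also have "\<dots> = (\<Prod>i\<in>?U. p + p') * x"
    using fin by (subst prod_add) (simp_all add: sum_distrib_right)
  also have "\<dots> = x" by (simp add: p)
  finally have prob_UN: "prob (\<Union>R\<in>\<R>. F R) \<le> x" .
  define F\<^sub>V where "F\<^sub>V S = {s \<in> space M. card S \<le> 3 * card {i \<in> S. V i s < c}}" for S
  define F\<^sub>E where "F\<^sub>E = (\<Union>R\<in>\<R>. F R)"
  have V_ev: "F\<^sub>V S \<in> events" "prob (F\<^sub>V S) \<le> (1 / 2) ^ card S" if "finite S" for S
    unfolding F\<^sub>V_def by (rule prob_many_bad_vertices[OF that c])+
  have E_ev: "F\<^sub>E \<in> events" unfolding F\<^sub>E_def using F_ev fin\<R> by (intro sets.finite_UN) auto
  let ?E = "(F\<^sub>V A \<union> F\<^sub>V B) \<union> F\<^sub>E"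
  have "prob ?E \<le> (1 / 2) ^ card A + (1 / 2) ^ card B + x"
    using measure_Un_le[of "F\<^sub>V A \<union> F\<^sub>V B" M F\<^sub>E] measure_Un_le[of "F\<^sub>V A" M "F\<^sub>V B"]
      V_ev[OF fin(1)] V_ev[OF fin(2)] E_ev prob_UN[folded F\<^sub>E_def] by auto
  moreover have "s \<in> ?E" if s: "s \<in> space M"
    and none: "\<forall>a\<in>A. \<forall>b\<in>B. \<not> (c \<le> V a s \<and> c \<le> V b s \<and> \<omega> {a, b} s \<le> t)" for s
  proof (rule ccontr)
    assume no: "s \<notin> ?E"
    let ?R = "{i \<in> ?U. c \<le> V i s}"
    have count: "2 * card S \<le> 3 * card (?R \<inter> S)" if "s \<notin> F\<^sub>V S" "finite S" "S \<subseteq> ?U" for S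
    proof -
      have "card S = card ((?R \<inter> S) \<union> {i \<in> S. V i s < c})"
        using that(3) by (intro arg_cong[where f = card]) auto
      also have "\<dots> = card (?R \<inter> S) + card {i \<in> S. V i s < c}"
        using that(2) by (intro card_Un_disjoint) auto
      finally show ?thesis using that(1) s by (simp add: F\<^sub>V_def)
    qed
    have R: "?R \<in> \<R>" unfolding \<R>_def using count[of A] count[of B] no fin by auto
    have "t < \<omega> e s" if "e \<in> E ?R" for e
    proof -
      from that obtain a b where "a \<in> A" "b \<in> B" "c \<le> V a s" "c \<le> V b s" "e = {a, b}"
        unfolding E_def by blast
      then show ?thesis using none by (meson not_le)
    qed
    then have "case_sum V \<omega> j s \<in> Y ?R j" if "j \<in> J ?R" for j
      using that unfolding J_def Y_def by (cases j) (simp_all add: Plus_def not_le image_iff)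
    then have "s \<in> F ?R" using s unfolding F_def by blast
    then show False using R no unfolding F\<^sub>E_def by blast
  qed
  ultimately show ?thesis unfolding x_def q_def using V_ev fin E_ev
    by (intro bexI[of _ ?E] conjI subsetI) auto
qed

end

section \<open>Events of asymptotically full probability\<close>

text \<open>Only the exceptional events are required to be measurable. Properties of walks and passage times
  can then be combined without checking that they are measurable.\<close>

definition (in prob_space) whp :: "(nat \<Rightarrow> 'a \<Rightarrow> bool) \<Rightarrow> bool" where
  "whp P \<longleftrightarrow> (\<exists>E. (\<forall>n. E n \<in> events) \<and> (\<lambda>n. prob (E n)) \<longlonglongrightarrow> 0 \<and>
      (\<forall>\<^sub>F n in sequentially. \<forall>s \<in> space M - E n. P n s))"

context prob_space
begin

lemma whpI:
  assumes "\<And>n. E n \<in> events" "(\<lambda>n. prob (E n)) \<longlonglongrightarrow> 0"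
    and "\<forall>\<^sub>F n in sequentially. \<forall>s \<in> space M - E n. P n s"
  shows "whp P"
  unfolding whp_def using assms by (intro exI[of _ E]) simp

lemma whpE:
  assumes "whp P"
  obtains E where "\<forall>n. E n \<in> events" "(\<lambda>n. prob (E n)) \<longlonglongrightarrow> 0"
    "\<forall>\<^sub>F n in sequentially. \<forall>s \<in> space M - E n. P n s"
proof -
  from assms obtain E where E: "\<forall>n. E n \<in> events" "(\<lambda>n. prob (E n)) \<longlonglongrightarrow> 0"
    "\<forall>\<^sub>F n in sequentially. \<forall>s \<in> space M - E n. P n s"
    unfolding whp_def by (elim exE conjE)
  show thesis by (rule that[OF E])
qed

lemma whp_mono:
  assumes "whp P" "\<forall>\<^sub>F n in sequentially. \<forall>s \<in> space M. P n s \<longrightarrow> Q n s"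
  shows "whp Q"
proof -
  obtain E where E: "\<forall>n. E n \<in> events" "(\<lambda>n. prob (E n)) \<longlonglongrightarrow> 0"
      "\<forall>\<^sub>F n in sequentially. \<forall>s \<in> space M - E n. P n s"
    by (rule whpE[OF assms(1)])
  have "\<forall>\<^sub>F n in sequentially. \<forall>s \<in> space M - E n. Q n s"
    using E(3) assms(2) by eventually_elim auto
  then show ?thesis by (rule whpI[OF E(1)[rule_format] E(2)])
qed

lemma whp_conj:
  assumes "whp P" "whp Q"
  shows "whp (\<lambda>n s. P n s \<and> Q n s)"
proof -
  obtain E where E: "\<forall>n. E n \<in> events" "(\<lambda>n. prob (E n)) \<longlonglongrightarrow> 0"
      "\<forall>\<^sub>F n in sequentially. \<forall>s \<in> space M - E n. P n s"
    by (rule whpE[OF assms(1)])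
  obtain F where F: "\<forall>n. F n \<in> events" "(\<lambda>n. prob (F n)) \<longlonglongrightarrow> 0"
      "\<forall>\<^sub>F n in sequentially. \<forall>s \<in> space M - F n. Q n s"
    by (rule whpE[OF assms(2)])
  have "(\<lambda>n. prob (E n \<union> F n)) \<longlonglongrightarrow> 0"
  proof (rule tendsto_sandwich[OF _ _ tendsto_const])
    show "\<forall>\<^sub>F n in sequentially. prob (E n \<union> F n) \<le> prob (E n) + prob (F n)"
      by (intro always_eventually allI measure_Un_le E(1)[rule_format] F(1)[rule_format])
    show "(\<lambda>n. prob (E n) + prob (F n)) \<longlonglongrightarrow> 0"
      using tendsto_add[OF E(2) F(2)] by simp
  qed auto
  moreover have "\<forall>\<^sub>F n in sequentially. \<forall>s \<in> space M - (E n \<union> F n). P n s \<and> Q n s"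
    using E(3) F(3) by eventually_elim auto
  ultimately show ?thesis by (intro whpI[of "\<lambda>n. E n \<union> F n"] sets.Un E(1)[rule_format] F(1)[rule_format])
qed

text \<open>The union bound: \<open>g\<close> bounds the number of indices, \<open>f\<close> the failure probability
  of each.\<close>

lemma whp_ball:
  assumes fin: "\<And>n. finite (I n)"
    and bad: "\<forall>\<^sub>F n in sequentially. \<forall>i \<in> I n. \<exists>E \<in> events. prob E \<le> f n \<and> {s \<in> space M. \<not> P n i s} \<subseteq> E"
    and card: "\<forall>\<^sub>F n in sequentially. real (card (I n)) \<le> g n"
    and lim: "(\<lambda>n. g n * f n) \<longlonglongrightarrow> 0" and f: "\<And>n. 0 \<le> f n"
  shows "whp (\<lambda>n s. \<forall>i \<in> I n. P n i s)"
proof -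
  define good where "good n \<longleftrightarrow> (\<forall>i \<in> I n. \<exists>E \<in> events. prob E \<le> f n \<and> {s \<in> space M. \<not> P n i s} \<subseteq> E)" for n
  define E where "E n i = (SOME E. E \<in> events \<and> prob E \<le> f n \<and> {s \<in> space M. \<not> P n i s} \<subseteq> E)" for n i
  have E: "E n i \<in> events \<and> prob (E n i) \<le> f n \<and> {s \<in> space M. \<not> P n i s} \<subseteq> E n i"
    if "good n" "i \<in> I n" for n i
  proof -
    have "\<exists>E. E \<in> events \<and> prob E \<le> f n \<and> {s \<in> space M. \<not> P n i s} \<subseteq> E"
      using that unfolding good_def by (simp only: Bex_def)
    then show ?thesis unfolding E_def by (rule someI_ex)
  qed
  define F where "F n = (if good n then \<Union>i\<in>I n. E n i else {})" for n
  have ev: "F n \<in> events" for n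
  proof (cases "good n")
    case True
    then show ?thesis using E[OF True] fin[of n] by (simp add: F_def sets.finite_UN)
  qed (simp add: F_def)
  have "\<forall>\<^sub>F n in sequentially. prob (F n) \<le> g n * f n"
    using bad[folded good_def] card
  proof eventually_elim
    case (elim n)
    have "prob (F n) \<le> (\<Sum>i\<in>I n. prob (E n i))"
      using elim(1) E[OF elim(1)] fin[of n]
      by (simp add: F_def) (intro finite_measure_subadditive_finite image_subsetI; simp)
    also have "\<dots> \<le> (\<Sum>i\<in>I n. f n)" using E[OF elim(1)] by (intro sum_mono) simp
    also have "\<dots> \<le> g n * f n" using elim(2) f[of n] by (simp add: mult_right_mono)
    finally show ?case .
  qed
  then have "(\<lambda>n. prob (F n)) \<longlonglongrightarrow> 0"
    by (intro tendsto_sandwich[OF _ _ tendsto_const lim]) auto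
  moreover have "\<forall>\<^sub>F n in sequentially. \<forall>s \<in> space M - F n. \<forall>i \<in> I n. P n i s"
    using bad[folded good_def]
  proof eventually_elim
    case (elim n)
    show ?case
    proof (intro ballI)
      fix s i assume s: "s \<in> space M - F n" and i: "i \<in> I n"
      then have "s \<notin> E n i" using elim by (auto simp: F_def)
      then show "P n i s" using E[OF elim i] s by blast
    qed
  qed
  ultimately show ?thesis by (rule whpI[OF ev])
qed

lemma whp_AE:
  assumes "AE s in M. P s"
  shows "whp (\<lambda>n. P)"
proof -
  obtain N where "{s \<in> space M. \<not> P s} \<subseteq> N" "prob N = 0" "N \<in> events"
    using assms by (auto elim!: AE_E simp: emeasure_eq_measure)
  then show ?thesis by (intro whpI[of "\<lambda>_. N"]) auto
qed

lemma prob_tendsto_0_of_whp: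
  assumes "whp P" "\<And>n s. s \<in> space M \<Longrightarrow> P n s \<Longrightarrow> s \<notin> A n"
    and "\<And>n. A n \<subseteq> space M"
  shows "(\<lambda>n. prob (A n)) \<longlonglongrightarrow> 0"
proof -
  obtain E where E: "\<forall>n. E n \<in> events" "(\<lambda>n. prob (E n)) \<longlonglongrightarrow> 0"
      "\<forall>\<^sub>F n in sequentially. \<forall>s \<in> space M - E n. P n s"
    by (rule whpE[OF assms(1)])
  have "\<forall>\<^sub>F n in sequentially. prob (A n) \<le> prob (E n)"
    using E(3)
  proof eventually_elim
    case (elim n)
    have "A n \<subseteq> E n"
    proof
      fix s assume s: "s \<in> A n"
      then have "s \<in> space M" using assms(3) by blast
      then show "s \<in> E n" using elim assms(2)[of s n] s by blast
    qed
    then show ?case by (intro finite_measure_mono E(1)[rule_format])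
  qed
  then show ?thesis by (intro tendsto_sandwich[OF _ _ tendsto_const E(2)]) auto
qed

end

section \<open>Asymptotics of the laws and union bounds over a cube\<close>

lemma polynomial_mult_stretched_exp_tendsto_0:
  fixes A c e p :: real
  assumes "0 < c" "0 < e"
  shows "(\<lambda>n. A * real n powr p * exp (- (c * real n powr e))) \<longlonglongrightarrow> 0"
  using assms by real_asymp

text \<open>This follows from \<open>1 / 2 \<le> exp (- 1 / 2)\<close>. It turns lower bounds on the size of a cube,
  which are powers of \<open>n\<close>, into stretched exponential failure probabilities.\<close>

lemma half_power_le_exp:
  assumes "r \<le> real k" shows "(1 / 2) ^ k \<le> exp (- (r / 2))"
proof -
  have "(1 / 2 :: real) ^ k \<le> exp (- 1 / 2) ^ k"
    using exp_ge_add_one_self[of "- 1 / 2 :: real"] by (intro power_mono) auto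
  also have "\<dots> = exp (- (real k / 2))" by (simp add: exp_of_nat_mult[symmetric])
  also have "\<dots> \<le> exp (- (r / 2))" using assms by simp
  finally show ?thesis .
qed

lemma card_cube_pairs_le:
  assumes "0 \<le> L" "1 \<le> n" "I \<subseteq> cube (0 :: int ^ 'd) (L * real n) \<times> cube (0 :: int ^ 'd) (L * real n)"
  shows "real (card I) \<le> (2 * L + 1) ^ (2 * CARD('d)) * real n powr (2 * real CARD('d))"
proof -
  let ?\<Lambda> = "cube (0 :: int ^ 'd) (L * real n)"
  have "card I \<le> card (?\<Lambda> \<times> ?\<Lambda>)"
    using assms(3) by (intro card_mono finite_cartesian_product finite_cube)
  then have "real (card I) \<le> real (card ?\<Lambda>) * real (card ?\<Lambda>)"
    by (simp add: card_cartesian_product flip: of_nat_mult)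
  also have "\<dots> \<le> (2 * (L * real n) + 1) ^ CARD('d) * (2 * (L * real n) + 1) ^ CARD('d)"
    using assms by (intro mult_mono card_cube_le) auto
  also have "\<dots> = (2 * (L * real n) + 1) ^ (2 * CARD('d))"
    by (simp only: mult_2[of "CARD('d)"] power_add)
  also have "\<dots> \<le> ((2 * L + 1) * real n) ^ (2 * CARD('d))"
    using assms by (intro power_mono) (auto simp: algebra_simps)
  also have "\<dots> = (2 * L + 1) ^ (2 * CARD('d)) * real n powr (2 * real CARD('d))"
    using assms powr_realpow[of "real n" "2 * CARD('d)"] by (simp add: power_mult_distrib)
  finally show ?thesis .
qed

context ilrfpp_standing
begin

lemma real_distribution_nu: "real_distribution \<nu>"
  using prob_space_nu sets_nu by (simp add: real_distribution_def real_distribution_axioms_def)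

lemma real_distribution_mu: "real_distribution \<mu>"
  using prob_space_mu sets_mu by (simp add: real_distribution_def real_distribution_axioms_def)

lemma nu_near_0: "((\<lambda>c. measure \<nu> {..<c}) \<longlongrightarrow> 0) (at_right 0)"
proof -
  interpret \<nu>: real_distribution \<nu> by (rule real_distribution_nu)
  have "measure \<nu> {..0} = 0"
  proof -
    have "AE t in \<nu>. t \<notin> {..0}" using V_pos by eventually_elim auto
    then show ?thesis by (simp add: \<nu>.prob_eq_0 sets_nu)
  qed
  then have lim: "((\<lambda>c. measure \<nu> {..c}) \<longlongrightarrow> 0) (at_right 0)"
    using \<nu>.cdf_is_right_cont[of 0] by (simp add: continuous_within cdf_def)
  show ?thesis
    by (rule tendsto_sandwich[OF _ _ tendsto_const lim])
      (auto intro!: always_eventually \<nu>.finite_measure_mono)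
qed

lemma mu_tail: "((\<lambda>K. measure \<mu> {K<..}) \<longlongrightarrow> 0) at_top"
proof -
  interpret \<mu>: real_distribution \<mu> by (rule real_distribution_mu)
  have "measure \<mu> {K<..} = 1 - cdf \<mu> K" for K
  proof -
    have "UNIV - {..K} = {K<..}" by auto
    then show ?thesis using \<mu>.prob_compl[of "{..K}"] by (auto simp: cdf_def)
  qed
  moreover have "((\<lambda>K. 1 - cdf \<mu> K) \<longlongrightarrow> 1 - 1) at_top"
    by (intro tendsto_intros \<mu>.cdf_lim_at_top_prob)
  ultimately show ?thesis by simp
qed

text \<open>The limit assumption compares logarithms only, so the exponent has to be enlarged slightly. The
  lower bound \<open>0\<close> on the quotient excludes \<open>measure \<mu> {..t} = 0\<close>, where
  \<open>ln 0 = 0\<close> would make the quotient vanish.\<close>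

lemma mu_near_0_ge:
  assumes "\<theta> < \<theta>'"
  shows "\<forall>\<^sub>F t in at_right 0. t powr \<theta>' \<le> measure \<mu> {..t}"
proof -
  have "\<forall>\<^sub>F t in at_right 0. 0 < ln (measure \<mu> {..t}) / ln t"
    using omega_near_0 theta_pos by (rule order_tendstoD(1))
  moreover have "\<forall>\<^sub>F t in at_right 0. ln (measure \<mu> {..t}) / ln t < \<theta>'"
    using omega_near_0 assms by (rule order_tendstoD(2))
  moreover have "\<forall>\<^sub>F t in at_right 0. t \<in> {0<..<1 :: real}"
    by (rule eventually_at_right_real) simp
  ultimately show ?thesis
  proof eventually_elim
    case (elim t)
    then have "measure \<mu> {..t} \<noteq> 0" by auto
    then have pos: "0 < measure \<mu> {..t}" by (simp add: zero_less_measure_iff)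
    have "\<theta>' * ln t \<le> ln (measure \<mu> {..t})"
      using elim by (simp add: divide_less_eq)
    then have "exp (\<theta>' * ln t) \<le> measure \<mu> {..t}"
      using pos by (simp add: ln_ge_iff)
    then show ?case using elim by (simp add: powr_def)
  qed
qed

lemma weight_threshold:
  assumes "0 < \<eta>"
  shows "(\<lambda>n. measure \<nu> {..<real n powr - \<eta>}) \<longlonglongrightarrow> 0"
proof (rule filterlim_compose[OF nu_near_0])
  show "filterlim (\<lambda>n. real n powr - \<eta>) (at_right 0) sequentially"
    using assms by real_asymp
qed

lemma eventually_weight_threshold:
  assumes "0 < \<eta>"
  shows "\<forall>\<^sub>F n in sequentially. measure \<nu> {..<real n powr - \<eta>} \<le> 1 / 64"
  using order_tendstoD(2)[OF weight_threshold[OF assms], of "1 / 64"]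
  by (auto elim: eventually_mono)

lemma eventually_noise_threshold:
  assumes "0 < \<eta>"
  shows "\<forall>\<^sub>F n in sequentially. measure \<mu> {real n powr \<eta><..} \<le> 1 / 64"
proof -
  have "filterlim (\<lambda>n. real n powr \<eta>) at_top sequentially"
    using assms by real_asymp
  from order_tendstoD(2)[OF filterlim_compose[OF mu_tail this], of "1 / 64"]
  show ?thesis by (auto elim: eventually_mono)
qed

lemma whp_heavy:
  assumes "0 < \<eta>"
  shows "whp (\<lambda>n s. real n powr - \<eta> \<le> V (y n) s)"
proof -
  have "whp (\<lambda>n s. \<forall>i\<in>{y n}. real n powr - \<eta> \<le> V i s)"
  proof (rule whp_ball[where g = "\<lambda>_. 1"])
    show "(\<lambda>n. 1 * measure \<nu> {..<real n powr - \<eta>}) \<longlonglongrightarrow> 0"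
      using weight_threshold[OF assms] by simp
    show "\<forall>\<^sub>F n in sequentially. \<forall>i\<in>{y n}. \<exists>E\<in>events.
        prob E \<le> measure \<nu> {..<real n powr - \<eta>} \<and> {s \<in> space M. \<not> real n powr - \<eta> \<le> V i s} \<subseteq> E"
    proof (intro always_eventually allI ballI)
      fix n i
      show "\<exists>E\<in>events. prob E \<le> measure \<nu> {..<real n powr - \<eta>}
          \<and> {s \<in> space M. \<not> real n powr - \<eta> \<le> V i s} \<subseteq> E"
        by (rule bexI[of _ "V i -` {..<real n powr - \<eta>} \<inter> space M"]) (auto simp: prob_V)
    qed
  qed auto
  then show ?thesis by simp
qed

lemma whp_regular:
  "whp (\<lambda>n s. (\<forall>z. 0 < V z s) \<and> (\<forall>e \<in> edges. 0 \<le> \<omega> e s))"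
proof (rule whp_AE)
  have "AE s in M. 0 < V z s" for z
    using V_pos unfolding law_V[of z, symmetric] by (rule AE_distrD[OF V_measurable])
  then have "AE s in M. \<forall>z. 0 < V z s"
    by (simp only: AE_all_countable simp_thms)
  moreover have "AE s in M. 0 \<le> \<omega> e s" if "e \<in> edges" for e
    using omega_nonneg unfolding law_omega[OF that, symmetric]
    by (rule AE_distrD[OF omega_measurable[OF that]])
  moreover have "countable (edges :: (int ^ 'd) set set)"
  proof (rule countable_subset)
    show "edges \<subseteq> (\<lambda>(x, y). {x, y}) ` (UNIV :: ((int ^ 'd) \<times> (int ^ 'd)) set)"
      by (auto simp: edges_def)
    show "countable ((\<lambda>(x, y). {x, y}) ` (UNIV :: ((int ^ 'd) \<times> (int ^ 'd)) set))"
      by (rule countable_image) (rule countableI_type)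
  qed
  then have "(AE s in M. \<forall>e \<in> edges. 0 \<le> \<omega> e s) \<longleftrightarrow> (\<forall>e \<in> edges. AE s in M. 0 \<le> \<omega> e s)"
    by (rule AE_ball_countable)
  ultimately show "AE s in M. (\<forall>z. 0 < V z s) \<and> (\<forall>e \<in> edges. 0 \<le> \<omega> e s)"
    by (intro AE_conjI) blast+
qed

text \<open>Removing \<open>u\<close> and \<open>v\<close> from the cube costs two vertices, hence the factor
  \<open>exp 1\<close> in the failure probability.\<close>

lemma whp_relay:
  assumes "0 < b" "0 < \<eta>" "0 \<le> L"
  shows "whp (\<lambda>n s. \<forall>u \<in> cube 0 (L * real n). \<forall>v \<in> cube 0 (L * real n).
    \<exists>z \<in> cube u (real n powr b) - {u, v}. real n powr - \<eta> \<le> V z s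
      \<and> \<omega> {u, z} s \<le> real n powr \<eta> \<and> \<omega> {v, z} s \<le> real n powr \<eta>)"
proof -
  let ?D = "CARD('d)"
  define I where "I n = cube (0 :: int ^ 'd) (L * real n) \<times> cube (0 :: int ^ 'd) (L * real n)" for n
  define P where "P n = (\<lambda>(u, v) s. \<exists>z \<in> cube u (real n powr b) - {u, v}. real n powr - \<eta> \<le> V z s
      \<and> \<omega> {u, z} s \<le> real n powr \<eta> \<and> \<omega> {v, z} s \<le> real n powr \<eta>)" for n
  let ?f = "\<lambda>n. 3 * exp 1 * exp (- (1 / 2 * real n powr (b * ?D)))"
  have "whp (\<lambda>n s. \<forall>i \<in> I n. P n i s)"
  proof (rule whp_ball)
    show "finite (I n)" for n by (simp add: I_def finite_cube)
    show "\<forall>\<^sub>F n in sequentially. real (card (I n)) \<le> (2 * L + 1) ^ (2 * ?D) * real n powr (2 * real ?D)"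
      using eventually_ge_at_top[of 1]
      by eventually_elim (rule card_cube_pairs_le[OF \<open>0 \<le> L\<close>], auto simp: I_def)
    have "(\<lambda>n. ((2 * L + 1) ^ (2 * ?D) * (3 * exp 1)) * real n powr (2 * real ?D)
        * exp (- (1 / 2 * real n powr (b * ?D)))) \<longlonglongrightarrow> 0"
      using assms by (intro polynomial_mult_stretched_exp_tendsto_0) auto
    then show "(\<lambda>n. ((2 * L + 1) ^ (2 * ?D) * real n powr (2 * real ?D)) * ?f n) \<longlonglongrightarrow> 0"
      by (simp add: mult_ac)
    show "\<forall>\<^sub>F n in sequentially. \<forall>i \<in> I n. \<exists>E \<in> events. prob E \<le> ?f n \<and> {s \<in> space M. \<not> P n i s} \<subseteq> E"
      using eventually_weight_threshold[OF \<open>0 < \<eta>\<close>] eventually_noise_threshold[OF \<open>0 < \<eta>\<close>]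
        eventually_ge_at_top[of 1]
    proof eventually_elim
      case (elim n)
      show ?case
      proof (rule ballI)
        fix i assume "i \<in> I n"
        obtain u v where i: "i = (u, v)" by (cases i)
        let ?Z = "cube u (real n powr b) - {u, v}"
        obtain E where E: "E \<in> events" "prob E \<le> 3 * (1 / 2) ^ card ?Z"
          "{s \<in> space M. \<forall>z\<in>?Z. \<not> (real n powr - \<eta> \<le> V z s \<and> \<omega> {u, z} s \<le> real n powr \<eta>
              \<and> \<omega> {v, z} s \<le> real n powr \<eta>)} \<subseteq> E"
          using prob_no_relay[of ?Z u v "real n powr - \<eta>" "real n powr \<eta>"] elim
          by (auto simp: finite_cube)
        have "real n powr (b * ?D) \<le> real (card (cube u (real n powr b)))"
          using card_cube_ge[of "real n powr b" u] elim(3) by (simp add: powr_power mult.commute)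
        moreover have "card (cube u (real n powr b)) \<le> card ?Z + 2"
        proof -
          have "card (cube u (real n powr b)) - card {u, v} \<le> card ?Z"
            by (rule diff_card_le_card_Diff) simp
          moreover have "card {u, v} \<le> 2" by (simp add: card_insert_if)
          ultimately show ?thesis by linarith
        qed
        ultimately have "real n powr (b * ?D) - 2 \<le> real (card ?Z)" by linarith
        from half_power_le_exp[OF this]
        have "(1 / 2) ^ card ?Z \<le> exp (1 + - (1 / 2 * real n powr (b * ?D)))"
          by (simp add: diff_divide_distrib)
        then have "3 * (1 / 2) ^ card ?Z \<le> ?f n" unfolding exp_add by linarith
        moreover have P: "{s \<in> space M. \<not> P n i s} \<subseteq> E"
          by (rule subset_trans[OF _ E(3)]) (auto simp: P_def i)
        ultimately show "\<exists>E \<in> events. prob E \<le> ?f n \<and> {s \<in> space M. \<not> P n i s} \<subseteq> E"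
          using E(1,2) P by (intro bexI[of _ E]) auto
      qed
    qed
  qed auto
  then show ?thesis
  proof (rule whp_mono, intro always_eventually allI ballI impI)
    fix n s and u v :: "int ^ 'd"
    assume "\<forall>i \<in> I n. P n i s" "u \<in> cube 0 (L * real n)" "v \<in> cube 0 (L * real n)"
    then have "P n (u, v) s" by (simp add: I_def)
    then show "\<exists>z \<in> cube u (real n powr b) - {u, v}. real n powr - \<eta> \<le> V z s
        \<and> \<omega> {u, z} s \<le> real n powr \<eta> \<and> \<omega> {v, z} s \<le> real n powr \<eta>"
      by (simp add: P_def)
  qed
qed

text \<open>The cubes have \<open>n powr (b * d)\<close> vertices up to constants, so about
  \<open>n powr (2 * b * d)\<close> edges run between them. The slack \<open>\<kappa>\<close> in the noise threshold makes the
  expected number of usable ones a positive power of \<open>n\<close>.\<close>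

lemma whp_link:
  assumes b: "0 < b" and \<eta>: "0 < \<eta>" and L: "0 \<le> L"
    and \<kappa>: "0 < \<kappa>" "\<kappa> < 2 * real CARD('d) / \<theta>"
  shows "whp (\<lambda>n s. \<forall>u \<in> cube 0 (L * real n). \<forall>v \<in> cube 0 (L * real n).
    cube u (real n powr b / 3) \<inter> cube v (real n powr b / 3) = {} \<longrightarrow>
    (\<exists>x \<in> cube u (real n powr b / 3). \<exists>y \<in> cube v (real n powr b / 3).
      real n powr - \<eta> \<le> V x s \<and> real n powr - \<eta> \<le> V y s
      \<and> \<omega> {x, y} s \<le> real n powr - (b * (2 * real CARD('d) / \<theta> - \<kappa>))))"
proof -
  let ?D = "CARD('d)"
  define \<rho> where "\<rho> n = real n powr b / 3" for n
  define \<sigma> where "\<sigma> = 2 * real ?D / \<theta> - \<kappa>"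
  define t where "t n = real n powr - (b * \<sigma>)" for n
  have "0 < \<sigma>" using \<kappa> by (simp add: \<sigma>_def)
  \<comment> \<open>Room for \<open>\<theta>'\<close> slightly above \<open>\<theta>\<close> that still makes the exponent \<open>e\<close> of
    the number of usable edges positive.\<close>
  have "\<theta> < 2 * real ?D / \<sigma>"
    using \<open>0 < \<sigma>\<close> \<kappa> theta_pos by (simp add: \<sigma>_def field_simps)
  then obtain \<theta>' where \<theta>': "\<theta> < \<theta>'" "\<theta>' < 2 * real ?D / \<sigma>" using dense by blast
  define e where "e = b * (2 * real ?D - \<sigma> * \<theta>')"
  have "0 < e" unfolding e_def using b \<theta>'(2) \<open>0 < \<sigma>\<close> by (simp add: field_simps)
  define I where "I n = {(u, v) \<in> cube (0 :: int ^ 'd) (L * real n) \<times> cube (0 :: int ^ 'd) (L * real n).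
      cube u (\<rho> n) \<inter> cube v (\<rho> n) = {}}" for n
  define P where "P n = (\<lambda>(u, v) s. \<exists>x \<in> cube u (\<rho> n). \<exists>y \<in> cube v (\<rho> n).
      real n powr - \<eta> \<le> V x s \<and> real n powr - \<eta> \<le> V y s \<and> \<omega> {x, y} s \<le> t n)" for n
  let ?f = "\<lambda>n. 2 * exp (- (1 / 3 ^ ?D / 2 * real n powr (b * ?D)))
      + exp (- (4 / 9 / 9 ^ ?D * real n powr e))"
  have "whp (\<lambda>n s. \<forall>i \<in> I n. P n i s)"
  proof (rule whp_ball)
    show "finite (I n)" for n
      unfolding I_def by (rule finite_subset[of _ "cube 0 (L * real n) \<times> cube 0 (L * real n)"])
        (auto simp: finite_cube)
    show "\<forall>\<^sub>F n in sequentially. real (card (I n)) \<le> (2 * L + 1) ^ (2 * ?D) * real n powr (2 * real ?D)"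
      using eventually_ge_at_top[of 1]
      by eventually_elim (rule card_cube_pairs_le[OF L], auto simp: I_def)
    have "(\<lambda>n. (2 * L + 1) ^ (2 * ?D) * 2 * real n powr (2 * real ?D)
          * exp (- (1 / 3 ^ ?D / 2 * real n powr (b * ?D)))
        + (2 * L + 1) ^ (2 * ?D) * real n powr (2 * real ?D)
          * exp (- (4 / 9 / 9 ^ ?D * real n powr e))) \<longlonglongrightarrow> 0 + 0"
      using b \<open>0 < e\<close> by (intro tendsto_add polynomial_mult_stretched_exp_tendsto_0) auto
    then show "(\<lambda>n. ((2 * L + 1) ^ (2 * ?D) * real n powr (2 * real ?D)) * ?f n) \<longlonglongrightarrow> 0"
      by (simp add: algebra_simps)
    have "filterlim t (at_right 0) sequentially"
      unfolding t_def using b \<open>0 < \<sigma>\<close> by real_asymp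
    then have "\<forall>\<^sub>F n in sequentially. t n powr \<theta>' \<le> measure \<mu> {..t n}"
      by (rule eventually_compose_filterlim[OF mu_near_0_ge[OF \<theta>'(1)]])
    with eventually_weight_threshold[OF \<eta>] eventually_ge_at_top[of 1]
    show "\<forall>\<^sub>F n in sequentially. \<forall>i \<in> I n. \<exists>E \<in> events. prob E \<le> ?f n \<and> {s \<in> space M. \<not> P n i s} \<subseteq> E"
    proof eventually_elim
      case (elim n)
      show ?case
      proof (rule ballI)
        fix i assume "i \<in> I n"
        obtain u v where i: "i = (u, v)" by (cases i)
        let ?A = "cube u (\<rho> n)" and ?B = "cube v (\<rho> n)"
        have disj: "?A \<inter> ?B = {}" using \<open>i \<in> I n\<close> by (auto simp: I_def i)
        obtain E where E: "E \<in> events" "prob E \<le> (1 / 2) ^ card ?A + (1 / 2) ^ card ?B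
            + exp (- (4 / 9 * real (card ?A) * real (card ?B) * measure \<mu> {..t n}))"
          "{s \<in> space M. \<forall>a\<in>?A. \<forall>b\<in>?B. \<not> (real n powr - \<eta> \<le> V a s \<and> real n powr - \<eta> \<le> V b s
              \<and> \<omega> {a, b} s \<le> t n)} \<subseteq> E"
          using prob_no_link[OF finite_cube finite_cube disj, of "real n powr - \<eta>" "t n"] elim by auto
        have \<rho>D: "\<rho> n ^ ?D = 1 / 3 ^ ?D * real n powr (b * ?D)"
          using elim(2) by (simp add: \<rho>_def power_divide powr_power mult.commute)
        have A: "\<rho> n ^ ?D \<le> real (card ?A)" and B: "\<rho> n ^ ?D \<le> real (card ?B)"
          by (simp_all add: card_cube_ge \<rho>_def)
        have "(1 / 2) ^ card ?A + (1 / 2) ^ card ?B \<le> 2 * exp (- (1 / 3 ^ ?D / 2 * real n powr (b * ?D)))"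
          using half_power_le_exp[OF A] half_power_le_exp[OF B] by (simp add: \<rho>D)
        moreover have "4 / 9 / 9 ^ ?D * real n powr e
            \<le> 4 / 9 * real (card ?A) * real (card ?B) * measure \<mu> {..t n}"
        proof -
          have "real n powr e = real n powr (b * ?D) * real n powr (b * ?D) * t n powr \<theta>'"
            unfolding t_def powr_powr powr_add[symmetric] e_def by (simp add: algebra_simps)
          moreover have "(9 :: real) ^ ?D = 3 ^ ?D * 3 ^ ?D"
            using power_mult_distrib[of "3 :: real" 3 ?D] by simp
          ultimately have "4 / 9 / 9 ^ ?D * real n powr e = 4 / 9 * \<rho> n ^ ?D * \<rho> n ^ ?D * t n powr \<theta>'"
            by (simp add: \<rho>D)
          also have "\<dots> \<le> 4 / 9 * real (card ?A) * real (card ?B) * measure \<mu> {..t n}"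
            using A B elim by (intro mult_mono) (auto simp: \<rho>_def)
          finally show ?thesis .
        qed
        then have "exp (- (4 / 9 * real (card ?A) * real (card ?B) * measure \<mu> {..t n}))
            \<le> exp (- (4 / 9 / 9 ^ ?D * real n powr e))" by (simp only: exp_le_cancel_iff neg_le_iff_le)
        ultimately have "prob E \<le> ?f n" using E(2) by linarith
        moreover have P: "{s \<in> space M. \<not> P n i s} \<subseteq> E"
          by (rule subset_trans[OF _ E(3)]) (auto simp: P_def i)
        ultimately show "\<exists>E \<in> events. prob E \<le> ?f n \<and> {s \<in> space M. \<not> P n i s} \<subseteq> E"
          using E(1,2) P by (intro bexI[of _ E]) auto
      qed
    qed
  qed auto
  then show ?thesis unfolding \<rho>_def[symmetric] \<sigma>_def[symmetric] t_def[symmetric]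
  proof (rule whp_mono, intro always_eventually allI ballI impI)
    fix n s and u v :: "int ^ 'd"
    assume "\<forall>i \<in> I n. P n i s" "u \<in> cube 0 (L * real n)" "v \<in> cube 0 (L * real n)"
      "cube u (\<rho> n) \<inter> cube v (\<rho> n) = {}"
    then have "P n (u, v) s" by (simp add: I_def)
    then show "\<exists>x \<in> cube u (\<rho> n). \<exists>y \<in> cube v (\<rho> n).
        real n powr - \<eta> \<le> V x s \<and> real n powr - \<eta> \<le> V y s \<and> \<omega> {x, y} s \<le> t n"
      by (simp add: P_def)
  qed
qed

section \<open>Connection across scales\<close>

text \<open>The factor \<open>L\<close> is quantified because the step to a larger scale leaves the original cube
  slightly: it uses the smaller scale with \<open>L + 1\<close>.\<close>

definition connected_at_scale :: "real \<Rightarrow> real \<Rightarrow> real \<Rightarrow> bool" where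
  "connected_at_scale \<eta> \<tau> b \<longleftrightarrow> (\<forall>L\<ge>0. \<exists>C. whp (\<lambda>n s.
    \<forall>u \<in> cube 0 (L * real n). \<forall>v \<in> cube 0 (L * real n).
      v \<in> cube u (real n powr b) \<longrightarrow> real n powr - \<eta> \<le> V u s \<longrightarrow> real n powr - \<eta> \<le> V v s \<longrightarrow>
      walk_within \<alpha> (\<lambda>z. V z s) (\<lambda>e. \<omega> e s) u v (C * real n powr \<tau>)))"

lemma power_edge_time_le:
  fixes u v :: "int ^ 'd"
  assumes n: "1 \<le> n" and v: "v \<in> cube u (k * real n powr b)" and "0 \<le> k"
    and wt: "real n powr - \<eta> \<le> wt u" "real n powr - \<eta> \<le> wt v"
    and w: "0 \<le> w {u, v}" "w {u, v} \<le> real n powr \<sigma>"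
    and \<tau>: "b * \<alpha> + \<sigma> + 2 * \<eta> \<le> \<tau>"
  shows "edge_time \<alpha> wt w u v \<le> (real CARD('d) * k) powr \<alpha> * real n powr \<tau>"
proof -
  have "edge_time \<alpha> wt w u v \<le> (real CARD('d) * (k * real n powr b)) powr \<alpha> * real n powr \<sigma>
      / (real n powr - \<eta> * real n powr - \<eta>)"
    using n wt w alpha_pos by (intro edge_time_le[OF v]) auto
  also have "\<dots> = (real CARD('d) * k) powr \<alpha> * real n powr (b * \<alpha> + \<sigma> + 2 * \<eta>)"
  proof -
    have "real n powr (b * \<alpha> + \<sigma> + 2 * \<eta>)
        = real n powr (b * \<alpha>) * real n powr \<sigma> / (real n powr - \<eta> * real n powr - \<eta>)"
      unfolding powr_add[symmetric] powr_diff[symmetric] by simp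
    then show ?thesis using \<open>0 \<le> k\<close> by (simp add: powr_mult powr_powr mult_ac)
  qed
  also have "\<dots> \<le> (real CARD('d) * k) powr \<alpha> * real n powr \<tau>"
    using n \<tau> by (intro mult_left_mono powr_mono) auto
  finally show ?thesis .
qed

text \<open>Both edges of a route through one intermediate vertex have length of order \<open>n powr b\<close>, noise at
  most \<open>n powr \<eta>\<close> and heavy endpoints, which accounts for the exponent
  \<open>b * \<alpha> + 3 * \<eta>\<close>.\<close>

lemma connected_at_small_scale:
  assumes b: "0 < b" and \<eta>: "0 < \<eta>" and \<tau>: "b * \<alpha> + 3 * \<eta> \<le> \<tau>"
  shows "connected_at_scale \<eta> \<tau> b"
  unfolding connected_at_scale_def
proof (intro allI impI)
  fix L :: real assume "0 \<le> L"
  let ?C = "(real CARD('d) * 1) powr \<alpha> + (real CARD('d) * 2) powr \<alpha>"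
  show "\<exists>C. whp (\<lambda>n s. \<forall>u \<in> cube 0 (L * real n). \<forall>v \<in> cube 0 (L * real n).
      v \<in> cube u (real n powr b) \<longrightarrow> real n powr - \<eta> \<le> V u s \<longrightarrow> real n powr - \<eta> \<le> V v s \<longrightarrow>
      walk_within \<alpha> (\<lambda>z. V z s) (\<lambda>e. \<omega> e s) u v (C * real n powr \<tau>))"
  proof (intro exI[of _ ?C] whp_mono[OF whp_conj[OF whp_regular whp_relay[OF b \<eta> \<open>0 \<le> L\<close>]]]
      eventually_mono[OF eventually_ge_at_top[of 1]] ballI impI, elim conjE)
    fix n s and u v :: "int ^ 'd"
    assume n: "(1 :: nat) \<le> n" and pos: "\<forall>e \<in> edges. 0 \<le> \<omega> e s"
      and relay: "\<forall>u \<in> cube 0 (L * real n). \<forall>v \<in> cube 0 (L * real n).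
          \<exists>z \<in> cube u (real n powr b) - {u, v}. real n powr - \<eta> \<le> V z s
            \<and> \<omega> {u, z} s \<le> real n powr \<eta> \<and> \<omega> {v, z} s \<le> real n powr \<eta>"
      and uv: "u \<in> cube 0 (L * real n)" "v \<in> cube 0 (L * real n)" "v \<in> cube u (real n powr b)"
        "real n powr - \<eta> \<le> V u s" "real n powr - \<eta> \<le> V v s"
    obtain z where z: "z \<in> cube u (real n powr b)" "z \<noteq> u" "z \<noteq> v" "real n powr - \<eta> \<le> V z s"
        "\<omega> {u, z} s \<le> real n powr \<eta>" "\<omega> {z, v} s \<le> real n powr \<eta>"
      using bspec[OF bspec[OF relay uv(1)] uv(2)] by (auto simp: insert_commute)
    have nonneg: "0 \<le> \<omega> {u, z} s" "0 \<le> \<omega> {z, v} s"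
      using pos doubleton_mem_edges[of u z] doubleton_mem_edges[of z v] z(2,3) by auto
    have "edge_time \<alpha> (\<lambda>z. V z s) (\<lambda>e. \<omega> e s) u z \<le> (real CARD('d) * 1) powr \<alpha> * real n powr \<tau>"
      using z(1) \<tau> by (intro power_edge_time_le[where wt = "\<lambda>z. V z s" and w = "\<lambda>e. \<omega> e s" and b = b,
          OF n _ _ uv(4) z(4) nonneg(1) z(5)]) simp_all
    moreover have "v \<in> cube z (2 * real n powr b)"
      using cube_trans[OF z(1)[unfolded cube_commute[of z]] uv(3)] by simp
    then have "edge_time \<alpha> (\<lambda>z. V z s) (\<lambda>e. \<omega> e s) z v \<le> (real CARD('d) * 2) powr \<alpha> * real n powr \<tau>"
      using \<tau> by (intro power_edge_time_le[where wt = "\<lambda>z. V z s" and w = "\<lambda>e. \<omega> e s" and b = b,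
          OF n _ _ z(4) uv(5) nonneg(2) z(6)]) simp_all
    ultimately show "walk_within \<alpha> (\<lambda>z. V z s) (\<lambda>e. \<omega> e s) u v (?C * real n powr \<tau>)"
      unfolding distrib_right by (rule walk_within_trans[OF walk_within_edge walk_within_edge])
  qed
qed

text \<open>The route goes from \<open>u\<close> to a nearby \<open>x\<close>, over one long edge of small noise to a
  \<open>y\<close> near \<open>v\<close>, and on to \<open>v\<close>; the two end pieces belong to the smaller scale.\<close>

lemma connected_at_larger_scale:
  assumes b': "0 < b'" "b' \<le> 1" and \<eta>: "0 < \<eta>"
    and \<kappa>: "0 < \<kappa>" "\<kappa> < 2 * real CARD('d) / \<theta>"
    and \<tau>: "b * \<alpha> - b' * (2 * real CARD('d) / \<theta> - \<kappa>) + 2 * \<eta> \<le> \<tau>"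
    and b: "b' \<le> b" and IH: "connected_at_scale \<eta> \<tau> b'"
  shows "connected_at_scale \<eta> \<tau> b"
  unfolding connected_at_scale_def
proof (intro allI impI)
  fix L :: real assume L: "0 \<le> L"
  \<comment> \<open>If the cubes of radius \<open>\<rho> n\<close> around \<open>u\<close> and \<open>v\<close> meet, then \<open>u\<close> and
    \<open>v\<close> already are within the smaller scale, since \<open>2 / 3 \<le> 1\<close>.\<close>
  define \<rho> where "\<rho> n = real n powr b' / 3" for n
  define \<sigma> where "\<sigma> = - (b' * (2 * real CARD('d) / \<theta> - \<kappa>))"
  have "0 \<le> L + 1" using L by simp
  from IH[unfolded connected_at_scale_def, rule_format, OF this] obtain C where C: "whp (\<lambda>n s.
      \<forall>u \<in> cube 0 ((L + 1) * real n). \<forall>v \<in> cube 0 ((L + 1) * real n).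
        v \<in> cube u (real n powr b') \<longrightarrow> real n powr - \<eta> \<le> V u s \<longrightarrow> real n powr - \<eta> \<le> V v s \<longrightarrow>
        walk_within \<alpha> (\<lambda>z. V z s) (\<lambda>e. \<omega> e s) u v (C * real n powr \<tau>))"
    by (elim exE)
  let ?K = "(real CARD('d) * 3) powr \<alpha>"
  let ?C = "\<bar>C\<bar> + ?K + \<bar>C\<bar>"
  show "\<exists>C. whp (\<lambda>n s. \<forall>u \<in> cube 0 (L * real n). \<forall>v \<in> cube 0 (L * real n).
      v \<in> cube u (real n powr b) \<longrightarrow> real n powr - \<eta> \<le> V u s \<longrightarrow> real n powr - \<eta> \<le> V v s \<longrightarrow>
      walk_within \<alpha> (\<lambda>z. V z s) (\<lambda>e. \<omega> e s) u v (C * real n powr \<tau>))"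
  proof (intro exI[of _ ?C] whp_mono[OF whp_conj[OF whp_conj[OF whp_regular C]
        whp_link[OF b'(1) \<eta> L \<kappa>, folded \<rho>_def \<sigma>_def]]]
      eventually_mono[OF eventually_ge_at_top[of 1]] ballI impI, elim conjE)
    fix n s and u v :: "int ^ 'd"
    let ?W = "walk_within \<alpha> (\<lambda>z. V z s) (\<lambda>e. \<omega> e s)"
    assume n: "(1 :: nat) \<le> n"
      and pos: "\<forall>e \<in> edges. 0 \<le> \<omega> e s"
      and walk: "\<forall>u \<in> cube 0 ((L + 1) * real n). \<forall>v \<in> cube 0 ((L + 1) * real n).
          v \<in> cube u (real n powr b') \<longrightarrow> real n powr - \<eta> \<le> V u s \<longrightarrow> real n powr - \<eta> \<le> V v s \<longrightarrow>
          ?W u v (C * real n powr \<tau>)"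
      and link: "\<forall>u \<in> cube 0 (L * real n). \<forall>v \<in> cube 0 (L * real n).
          cube u (\<rho> n) \<inter> cube v (\<rho> n) = {} \<longrightarrow>
          (\<exists>x \<in> cube u (\<rho> n). \<exists>y \<in> cube v (\<rho> n).
            real n powr - \<eta> \<le> V x s \<and> real n powr - \<eta> \<le> V y s \<and> \<omega> {x, y} s \<le> real n powr \<sigma>)"
      and u: "u \<in> cube 0 (L * real n)" "real n powr - \<eta> \<le> V u s"
      and v: "v \<in> cube 0 (L * real n)" "real n powr - \<eta> \<le> V v s"
      and uv: "v \<in> cube u (real n powr b)"
    have \<rho>: "0 \<le> \<rho> n" "\<rho> n \<le> real n" "2 * \<rho> n \<le> real n powr b'" "\<rho> n \<le> real n powr b'"
      "\<rho> n \<le> real n powr b"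
    proof -
      have "real n powr b' \<le> real n powr 1" "real n powr b' \<le> real n powr b"
        using n b b' by (intro powr_mono; simp)+
      moreover have "0 \<le> real n powr b'" "0 \<le> real n powr b" by simp_all
      moreover have "real n powr 1 = real n" using n by simp
      ultimately show "0 \<le> \<rho> n" "\<rho> n \<le> real n" "2 * \<rho> n \<le> real n powr b'" "\<rho> n \<le> real n powr b'"
          "\<rho> n \<le> real n powr b"
        unfolding \<rho>_def by linarith+
    qed
    have larger: "z \<in> cube 0 ((L + 1) * real n)" if "x \<in> cube 0 (L * real n)" "z \<in> cube x (\<rho> n)" for x z
      by (rule subsetD[OF cube_mono cube_trans[OF that]]) (use \<rho>(2) in \<open>simp add: distrib_right\<close>)
    have near: "?W x z (\<bar>C\<bar> * real n powr \<tau>)"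
      if "x \<in> cube 0 ((L + 1) * real n)" "z \<in> cube 0 ((L + 1) * real n)" "z \<in> cube x (real n powr b')"
        "real n powr - \<eta> \<le> V x s" "real n powr - \<eta> \<le> V z s" for x z
    proof (rule walk_within_mono)
      show "?W x z (C * real n powr \<tau>)" using walk that by simp
      show "C * real n powr \<tau> \<le> \<bar>C\<bar> * real n powr \<tau>" by (intro mult_right_mono) auto
    qed
    have self: "x \<in> cube x (\<rho> n)" for x :: "int ^ 'd" using \<rho>(1) by (simp add: cube_def)
    show "?W u v (?C * real n powr \<tau>)"
    proof (cases "cube u (\<rho> n) \<inter> cube v (\<rho> n) = {}")
      case True
      then obtain x y where x: "x \<in> cube u (\<rho> n)" "real n powr - \<eta> \<le> V x s"
        and y: "y \<in> cube v (\<rho> n)" "real n powr - \<eta> \<le> V y s" and xy: "\<omega> {x, y} s \<le> real n powr \<sigma>"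
        using bspec[OF bspec[OF link u(1)] v(1), THEN mp, OF True] by (elim bexE conjE)
      have "x \<noteq> y" using True x(1) y(1) by blast
      then have nonneg: "0 \<le> \<omega> {x, y} s" by (rule bspec[OF pos doubleton_mem_edges])
      have "y \<in> cube x (\<rho> n + real n powr b + \<rho> n)"
        by (rule cube_trans[OF cube_trans[OF x(1)[unfolded cube_commute[of x]] uv] y(1)])
      then have y_near: "y \<in> cube x (3 * real n powr b)"
        by (rule subsetD[OF cube_mono, rotated]) (use \<rho>(5) in simp)
      have "edge_time \<alpha> (\<lambda>z. V z s) (\<lambda>e. \<omega> e s) x y \<le> ?K * real n powr \<tau>"
        using \<tau> by (intro power_edge_time_le[where wt = "\<lambda>z. V z s" and w = "\<lambda>e. \<omega> e s",
          OF n y_near _ x(2) y(2) nonneg xy]) (simp_all add: \<sigma>_def)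
      then have "?W x y (?K * real n powr \<tau>)" by (rule walk_within_edge)
      moreover have "?W u x (\<bar>C\<bar> * real n powr \<tau>)"
        by (rule near[OF larger[OF u(1) self] larger[OF u(1) x(1)] subsetD[OF cube_mono[OF \<rho>(4)] x(1)] u(2) x(2)])
      moreover have "?W y v (\<bar>C\<bar> * real n powr \<tau>)"
        by (rule near[OF larger[OF v(1) y(1)] larger[OF v(1) self]
              subsetD[OF cube_mono[OF \<rho>(4)] y(1)[unfolded cube_commute[of y]]] y(2) v(2)])
      ultimately show ?thesis unfolding distrib_right by (intro walk_within_trans[OF walk_within_trans])
    next
      case False
      then obtain w where w: "w \<in> cube u (\<rho> n)" "v \<in> cube w (\<rho> n)" by (auto simp: cube_commute[of v])
      have "v \<in> cube u (real n powr b')"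
        by (rule subsetD[OF cube_mono cube_trans[OF w]]) (use \<rho>(3) in simp)
      then have "?W u v (\<bar>C\<bar> * real n powr \<tau>)"
        by (rule near[OF larger[OF u(1) self] larger[OF v(1) self] _ u(2) v(2)])
      moreover have "\<bar>C\<bar> * real n powr \<tau> \<le> ?C * real n powr \<tau>"
        by (intro mult_right_mono) auto
      ultimately show ?thesis by (rule walk_within_mono)
    qed
  qed
qed

text \<open>Finitely many steps lead from \<open>\<beta> ^ k\<close> up to \<open>\<beta> ^ 0 = 1\<close>, with \<open>k\<close>
  depending on \<open>\<epsilon>\<close> but not on \<open>n\<close>.\<close>

lemma connected_at_linear_scale:
  assumes \<epsilon>: "0 < \<epsilon>" and \<Delta>: "\<Delta> = \<alpha> - 2 * real CARD('d) / \<theta>" "0 < \<Delta>"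
  shows "\<exists>\<eta>>0. connected_at_scale \<eta> (\<Delta> + \<epsilon>) 1"
proof -
  define D where "D = 2 * real CARD('d) / \<theta>"
  have "0 < D" using theta_pos by (simp add: D_def)
  have \<alpha>_eq: "\<alpha> = \<Delta> + D" by (simp add: \<Delta>(1) D_def)
  \<comment> \<open>The loss \<open>\<epsilon>\<close> in the exponent is divided: at most a quarter each for the heavy endpoints
    (\<open>2 * \<eta>\<close>), the noise threshold (\<open>\<kappa>\<close>) and the gap between successive scales
    (\<open>D * (1 - \<beta>)\<close>).\<close>
  define \<eta> where "\<eta> = \<epsilon> / 8"
  define \<kappa> where "\<kappa> = min (\<epsilon> / 4) (D / 2)"
  define \<beta> where "\<beta> = 1 - min (1 / 2) (\<epsilon> / (4 * D))"
  have \<eta>: "0 < \<eta>" and \<kappa>: "0 < \<kappa>" "\<kappa> < D" "\<kappa> \<le> \<epsilon> / 4"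
    using \<epsilon> \<open>0 < D\<close> by (auto simp: \<eta>_def \<kappa>_def)
  have \<beta>: "0 < \<beta>" "\<beta> < 1" using \<epsilon> \<open>0 < D\<close> by (auto simp: \<beta>_def)
  have \<beta>D: "D * (1 - \<beta>) \<le> \<epsilon> / 4"
  proof -
    have "D * (1 - \<beta>) \<le> D * (\<epsilon> / (4 * D))"
      using \<open>0 < D\<close> by (intro mult_left_mono) (auto simp: \<beta>_def)
    then show ?thesis using \<open>0 < D\<close> by simp
  qed
  have step: "connected_at_scale \<eta> (\<Delta> + \<epsilon>) (\<beta> ^ k)" if "connected_at_scale \<eta> (\<Delta> + \<epsilon>) (\<beta> ^ Suc k)" for k
  proof (rule connected_at_larger_scale[OF _ _ \<eta> \<kappa>(1) \<kappa>(2)[unfolded D_def] _ _ that])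
    let ?b = "\<beta> ^ k"
    have b: "0 < ?b" "?b \<le> 1" using \<beta> by (auto intro: power_le_one)
    show "0 < \<beta> ^ Suc k" "\<beta> ^ Suc k \<le> 1" "\<beta> ^ Suc k \<le> \<beta> ^ k"
      using \<beta> power_le_one[of \<beta> "Suc k"] by (simp_all add: mult_left_le_one_le)
    have "?b * (\<Delta> + D * (1 - \<beta>) + \<beta> * \<kappa>) \<le> 1 * (\<Delta> + \<epsilon> / 4 + 1 * (\<epsilon> / 4))"
      using b \<beta> \<beta>D \<kappa> \<Delta> \<open>0 < D\<close> by (intro mult_mono add_mono) auto
    also have "?b * (\<Delta> + D * (1 - \<beta>) + \<beta> * \<kappa>) = ?b * \<alpha> - \<beta> ^ Suc k * (D - \<kappa>)"
      unfolding \<alpha>_eq by (simp add: algebra_simps)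
    finally show "?b * \<alpha> - \<beta> ^ Suc k * (2 * real CARD('d) / \<theta> - \<kappa>) + 2 * \<eta> \<le> \<Delta> + \<epsilon>"
      unfolding D_def[symmetric] \<eta>_def using \<epsilon> by simp
  qed
  obtain k where k: "\<beta> ^ k < \<epsilon> / 2 / \<alpha>"
    using real_arch_pow_inv[of "\<epsilon> / 2 / \<alpha>" \<beta>] \<beta>(2) \<epsilon> alpha_pos by auto
  have "\<beta> ^ k * \<alpha> + 3 * \<eta> \<le> \<Delta> + \<epsilon>"
    using k alpha_pos \<epsilon> \<Delta>(2) by (simp add: \<eta>_def field_simps)
  then have "connected_at_scale \<eta> (\<Delta> + \<epsilon>) (\<beta> ^ k)"
    using \<beta>(1) \<eta> by (intro connected_at_small_scale) auto
  then have "connected_at_scale \<eta> (\<Delta> + \<epsilon>) (\<beta> ^ 0)"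
    by (rule inc_induct[of 0 k, rotated]) (use step in auto)
  then show ?thesis using \<eta> by auto
qed

lemma whp_first_passage_time_le:
  fixes x :: "real ^ 'd"
  assumes \<epsilon>: "0 < \<epsilon>" and \<Delta>: "\<Delta> = \<alpha> - 2 * real CARD('d) / \<theta>" "0 < \<Delta>" and x: "infnorm x \<le> 1"
  shows "\<exists>C. whp (\<lambda>n s. first_passage_time \<alpha> (\<lambda>z. V z s) (\<lambda>e. \<omega> e s) 0 (ceiling_vec (real n *\<^sub>R x))
      \<le> ereal (C * real n powr (\<Delta> + \<epsilon>)))"
proof -
  define y where "y n = ceiling_vec (real n *\<^sub>R x)" for n
  obtain \<eta> where \<eta>: "0 < \<eta>" and "connected_at_scale \<eta> (\<Delta> + \<epsilon>) 1"
    using connected_at_linear_scale[OF \<epsilon> \<Delta>] by blast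
  then obtain C where C: "whp (\<lambda>n s. \<forall>u \<in> cube 0 (1 * real n). \<forall>v \<in> cube 0 (1 * real n).
      v \<in> cube u (real n powr 1) \<longrightarrow> real n powr - \<eta> \<le> V u s \<longrightarrow> real n powr - \<eta> \<le> V v s \<longrightarrow>
      walk_within \<alpha> (\<lambda>z. V z s) (\<lambda>e. \<omega> e s) u v (C * real n powr (\<Delta> + \<epsilon>)))"
    unfolding connected_at_scale_def using zero_le_one by blast
  have y: "y n \<in> cube 0 (real n)" for n
  proof -
    have "\<bar>real_of_int \<lceil>real n * x $ i\<rceil>\<bar> \<le> real n" for i
    proof -
      have "\<bar>x $ i\<bar> \<le> 1" using component_le_infnorm_cart[of x i] x by linarith
      then have "\<bar>real n * x $ i\<bar> \<le> real n"
        by (simp add: abs_mult mult_left_le)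
      then have "\<lceil>real n * x $ i\<rceil> \<le> int n" "- int n \<le> \<lceil>real n * x $ i\<rceil>"
        by (simp_all add: abs_le_iff ceiling_le_iff le_ceiling_iff)
      then show ?thesis by linarith
    qed
    then show ?thesis by (simp add: y_def ceiling_vec_def cube_def)
  qed
  have "whp (\<lambda>n s. first_passage_time \<alpha> (\<lambda>z. V z s) (\<lambda>e. \<omega> e s) 0 (y n)
      \<le> ereal (C * real n powr (\<Delta> + \<epsilon>)))"
  proof (rule whp_mono[OF whp_conj[OF whp_conj[OF whp_regular C]
          whp_conj[OF whp_heavy[OF \<eta>, of "\<lambda>_. 0"] whp_heavy[OF \<eta>, of y]]]],
      intro always_eventually allI ballI impI, elim conjE)
    fix n s
    assume "\<forall>z. 0 < V z s" "\<forall>e \<in> edges. 0 \<le> \<omega> e s"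
      and walk: "\<forall>u \<in> cube 0 (1 * real n). \<forall>v \<in> cube 0 (1 * real n).
      v \<in> cube u (real n powr 1) \<longrightarrow> real n powr - \<eta> \<le> V u s \<longrightarrow> real n powr - \<eta> \<le> V v s \<longrightarrow>
      walk_within \<alpha> (\<lambda>z. V z s) (\<lambda>e. \<omega> e s) u v (C * real n powr (\<Delta> + \<epsilon>))"
      and heavy: "real n powr - \<eta> \<le> V 0 s" "real n powr - \<eta> \<le> V (y n) s"
    moreover have "(0 :: int ^ 'd) \<in> cube 0 (real n)" by (simp add: cube_def)
    then have "walk_within \<alpha> (\<lambda>z. V z s) (\<lambda>e. \<omega> e s) 0 (y n) (C * real n powr (\<Delta> + \<epsilon>))"
      using walk heavy y[of n] by auto
    ultimately show "first_passage_time \<alpha> (\<lambda>z. V z s) (\<lambda>e. \<omega> e s) 0 (y n)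
        \<le> ereal (C * real n powr (\<Delta> + \<epsilon>))"
      by (intro first_passage_time_le_walk) auto
  qed
  then show ?thesis unfolding y_def by blast
qed

end

theorem theorem3p5:
  fixes M :: "'a measure"
    and V :: "int ^ 'd \<Rightarrow> 'a \<Rightarrow> real"
    and \<omega> :: "(int ^ 'd) set \<Rightarrow> 'a \<Rightarrow> real"
    and \<nu> \<mu> :: "real measure"
    and \<alpha> \<gamma> \<theta> \<zeta> \<Delta> :: real
    and x :: "real ^ 'd"
  assumes "ilrfpp_standing M \<alpha> V \<omega> \<nu> \<mu> \<gamma> \<theta> \<zeta>"
    and "\<gamma> > \<theta>"
    and "2 * real CARD('d) / \<theta> < \<alpha>" and "\<alpha> < 2 * real CARD('d) / \<theta> + 1"
    and "\<Delta> = \<alpha> - 2 * real CARD('d) / \<theta>"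
    and "infnorm x \<le> 1" and "x \<noteq> 0"
  shows "\<forall>\<epsilon>>0. \<exists>C::real.
    (\<lambda>n. \<P>(s in M. first_passage_time \<alpha> (\<lambda>z. V z s) (\<lambda>e. \<omega> e s) 0 (ceiling_vec (real n *\<^sub>R x))
                    > ereal (C * real n powr (\<Delta> + \<epsilon>)))) \<longlonglongrightarrow> 0"
proof (intro allI impI)
  fix \<epsilon> :: real assume "0 < \<epsilon>"
  interpret ilrfpp_standing M \<alpha> V \<omega> \<nu> \<mu> \<gamma> \<theta> \<zeta> by (rule assms(1))
  have "0 < \<Delta>" using assms(3,5) by simp
  then obtain C where C: "whp (\<lambda>n s. first_passage_time \<alpha> (\<lambda>z. V z s) (\<lambda>e. \<omega> e s) 0
      (ceiling_vec (real n *\<^sub>R x)) \<le> ereal (C * real n powr (\<Delta> + \<epsilon>)))"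
    using whp_first_passage_time_le[OF \<open>0 < \<epsilon>\<close> assms(5) _ assms(6)] by blast
  show "\<exists>C. (\<lambda>n. \<P>(s in M. first_passage_time \<alpha> (\<lambda>z. V z s) (\<lambda>e. \<omega> e s) 0
      (ceiling_vec (real n *\<^sub>R x)) > ereal (C * real n powr (\<Delta> + \<epsilon>)))) \<longlonglongrightarrow> 0"
    by (rule exI[of _ C], rule prob_tendsto_0_of_whp[OF C]) (auto simp: not_less)
qed

end
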